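(* Suppose that $\mathbb{C}$ is infinitary extensive and has smooth monomorphisms, and that $\Sigma\colon\mathbb{C}\to\mathbb{C}$ has an initial algebra $(\mu\Sigma,\iota)$ and preserves strong epimorphisms, monomorphisms, and directed colimits. Then for every preorder $O\rightarrowtail\mu\Sigma\times\mu\Sigma$ the contextual preorder $\lesssim_O$ exists, i.e. there is a greatest relation on $\mu\Sigma$ which is both a congruence on $(\mu\Sigma,\iota)$ and contained in $O$.
   Context: Standing assumptions: $\mathbb{C}$ is complete, has finite coproducts, is well-powered, monomorphisms are stable under finite coproducts, and strong epimorphisms are stable under pullback; every morphism has a (strong epi, mono)-factorization, whose mono part is its image. A relation on $X$ is a subobject $\langle l_R,r_R\rangle\colon R\rightarrowtail X\times X$; relations on $X$ form a complete lattice under $\le$. $\Delta=\langle\mathrm{id},\mathrm{id}\rangle$; for $f\colon X\to Y$, $f_\star[R]$ is the image of $(f\times f)\circ\langle l_R,r_R\rangle$; the composite $R\cdot S$ is the image of $\langle l_R\circ\bar l,r_S\circ\bar r\rangle$ with $(\bar l,\bar r)$ the pullback of $r_R$ and $l_S$; a preorder is a relation $R$ with $\Delta\le R$ and $R\cdot R\le R$. The canonical lifting $\overline\Sigma R$ is the image of $\langle\Sigma l_R,\Sigma r_R\rangle$. A congruence on a $\Sigma$-algebra $(A,a)$ is a relation $R$ on $A$ with $a_\star[\overline\Sigma R]\le R$. $\mathbb{C}$ is infinitary extensive if it has small coproducts and for every set-indexed family $(X_i)$ the functor $\prod_i\mathbb{C}/X_i\to\mathbb{C}/\coprod_iX_i$,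 $(p_i)\mapsto\coprod_ip_i$, is an equivalence. $\mathbb{C}$ has smooth monomorphisms if for every object the join of a directed family of subobjects is the colimit of the corresponding directed diagram. *)

theory Defs
  imports Main "HOL-Library.FuncSet"
begin

section \<open>Categories, functors, equivalences\<close>

record ('o, 'm) cat =
  Ob  :: "'o set"
  Ar  :: "'m set"
  Dom :: "'m \<Rightarrow> 'o"
  Cod :: "'m \<Rightarrow> 'o"
  Id  :: "'o \<Rightarrow> 'm"
  Comp :: "'m \<Rightarrow> 'm \<Rightarrow> 'm"  (infixr "\<cdot>\<index>" 70)

text \<open>\<open>g \<cdot>\<^bsub>C\<^esub> f\<close> is \<open>g\<close> after \<open>f\<close>.\<close>

definition hom :: "('o, 'm) cat \<Rightarrow> 'o \<Rightarrow> 'o \<Rightarrow> 'm set" where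
  "hom C X Y = {f \<in> Ar C. Dom C f = X \<and> Cod C f = Y}"

locale category =
  fixes C :: "('o, 'm) cat" (structure)
  assumes dom_in: "f \<in> Ar C \<Longrightarrow> Dom C f \<in> Ob C"
    and cod_in: "f \<in> Ar C \<Longrightarrow> Cod C f \<in> Ob C"
    and id_in: "X \<in> Ob C \<Longrightarrow> Id C X \<in> hom C X X"
    and comp_in: "\<lbrakk>f \<in> hom C X Y; g \<in> hom C Y Z\<rbrakk> \<Longrightarrow> g \<cdot> f \<in> hom C X Z"
    and id_left: "f \<in> hom C X Y \<Longrightarrow> Id C Y \<cdot> f = f"
    and id_right: "f \<in> hom C X Y \<Longrightarrow> f \<cdot> Id C X = f"
    and comp_assoc: "\<lbrakk>f \<in> hom C W X; g \<in> hom C X Y; h \<in> hom C Y Z\<rbrakk> \<Longrightarrow>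
      h \<cdot> (g \<cdot> f) = (h \<cdot> g) \<cdot> f"

record ('o, 'm, 'p, 'n) funct =
  fobj :: "'o \<Rightarrow> 'p"
  farr :: "'m \<Rightarrow> 'n"

definition is_functor ::
  "('o, 'm) cat \<Rightarrow> ('p, 'n) cat \<Rightarrow> ('o, 'm, 'p, 'n) funct \<Rightarrow> bool" where
  "is_functor A B F \<longleftrightarrow>
     (\<forall>X \<in> Ob A. fobj F X \<in> Ob B) \<and>
     (\<forall>f \<in> Ar A. farr F f \<in> hom B (fobj F (Dom A f)) (fobj F (Cod A f))) \<and>
     (\<forall>X \<in> Ob A. farr F (Id A X) = Id B (fobj F X)) \<and>
     (\<forall>f \<in> Ar A. \<forall>g \<in> Ar A. Cod A f = Dom A g \<longrightarrow>
        farr F (g \<cdot>\<^bsub>A\<^esub> f) = farr F g \<cdot>\<^bsub>B\<^esub> farr F f)"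

definition id_functor :: "('o, 'm, 'o, 'm) funct" where
  "id_functor = \<lparr>fobj = (\<lambda>X. X), farr = (\<lambda>f. f)\<rparr>"

definition comp_functor ::
  "('p, 'n, 'q, 'k) funct \<Rightarrow> ('o, 'm, 'p, 'n) funct \<Rightarrow> ('o, 'm, 'q, 'k) funct" where
  "comp_functor G F = \<lparr>fobj = fobj G \<circ> fobj F, farr = farr G \<circ> farr F\<rparr>"

definition is_iso :: "('o, 'm) cat \<Rightarrow> 'm \<Rightarrow> bool" where
  "is_iso C f \<longleftrightarrow> f \<in> Ar C \<and> (\<exists>g \<in> hom C (Cod C f) (Dom C f).
     g \<cdot>\<^bsub>C\<^esub> f = Id C (Dom C f) \<and> f \<cdot>\<^bsub>C\<^esub> g = Id C (Cod C f))"

definition nat_iso ::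
  "('o, 'm) cat \<Rightarrow> ('p, 'n) cat \<Rightarrow> ('o, 'm, 'p, 'n) funct \<Rightarrow> ('o, 'm, 'p, 'n) funct \<Rightarrow>
    ('o \<Rightarrow> 'n) \<Rightarrow> bool" where
  "nat_iso A B F G t \<longleftrightarrow>
     (\<forall>X \<in> Ob A. t X \<in> hom B (fobj F X) (fobj G X) \<and> is_iso B (t X)) \<and>
     (\<forall>f \<in> Ar A. t (Cod A f) \<cdot>\<^bsub>B\<^esub> farr F f = farr G f \<cdot>\<^bsub>B\<^esub> t (Dom A f))"

definition is_equivalence ::
  "('o, 'm) cat \<Rightarrow> ('p, 'n) cat \<Rightarrow> ('o, 'm, 'p, 'n) funct \<Rightarrow> bool" where
  "is_equivalence A B F \<longleftrightarrow> is_functor A B F \<and>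
     (\<exists>G. is_functor B A G \<and>
       (\<exists>t. nat_iso A A id_functor (comp_functor G F) t) \<and>
       (\<exists>s. nat_iso B B (comp_functor F G) id_functor s))"

text \<open>An arrow of the slice from \<open>p\<close> to \<open>q\<close> is a triple \<open>(p, h, q)\<close> with \<open>q \<cdot> h = p\<close>.\<close>

definition slice_cat :: "('o, 'm) cat \<Rightarrow> 'o \<Rightarrow> ('m, 'm \<times> 'm \<times> 'm) cat" where
  "slice_cat C X = \<lparr>
     Ob = {p \<in> Ar C. Cod C p = X},
     Ar = {(p, h, q). p \<in> Ar C \<and> Cod C p = X \<and> q \<in> Ar C \<and> Cod C q = X \<and>
             h \<in> hom C (Dom C p) (Dom C q) \<and> q \<cdot>\<^bsub>C\<^esub> h = p},
     Dom = (\<lambda>(p, h, q). p),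
     Cod = (\<lambda>(p, h, q). q),
     Id = (\<lambda>p. (p, Id C (Dom C p), p)),
     Comp = (\<lambda>(_, h', q') (p, h, _). (p, h' \<cdot>\<^bsub>C\<^esub> h, q'))\<rparr>"

definition prod_cat :: "'i set \<Rightarrow> ('i \<Rightarrow> ('o, 'm) cat) \<Rightarrow> ('i \<Rightarrow> 'o, 'i \<Rightarrow> 'm) cat" where
  "prod_cat I A = \<lparr>
     Ob = (\<Pi>\<^sub>E i\<in>I. Ob (A i)),
     Ar = (\<Pi>\<^sub>E i\<in>I. Ar (A i)),
     Dom = (\<lambda>f. \<lambda>i\<in>I. Dom (A i) (f i)),
     Cod = (\<lambda>f. \<lambda>i\<in>I. Cod (A i) (f i)),
     Id = (\<lambda>X. \<lambda>i\<in>I. Id (A i) (X i)),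
     Comp = (\<lambda>g f. \<lambda>i\<in>I. g i \<cdot>\<^bsub>A i\<^esub> f i)\<rparr>"

section \<open>Smallness\<close>

text \<open>HOL has no proper classes, so ``small'' is a parameter: a predicate on the subsets of a type
  \<open>'u\<close> of indices, subject to the closure properties below. Sets of a set theory embedded in HOL
  are an instance, and so are the subsets of \<open>'u\<close> of cardinality below a regular cardinal.
  Closure under power sets is not demanded, so strictly more notions of smallness than those
  coming from a universe of sets are admitted.\<close>

locale smallness =
  fixes small :: "'u set \<Rightarrow> bool"
  assumes infinite_indices: "infinite (UNIV :: 'u set)"
    and small_finite: "finite I \<Longrightarrow> small I"
    and small_subset: "\<lbrakk>small I; J \<subseteq> I\<rbrakk> \<Longrightarrow> small J"
    and small_image: "small I \<Longrightarrow> small (f ` I)"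
    and small_Union: "\<lbrakk>small I; \<And>i. i \<in> I \<Longrightarrow> small (A i)\<rbrakk> \<Longrightarrow> small (\<Union>i\<in>I. A i)"

section \<open>Limits and colimits\<close>

definition is_cone ::
  "('j, 'k) cat \<Rightarrow> ('o, 'm) cat \<Rightarrow> ('j, 'k, 'o, 'm) funct \<Rightarrow> 'o \<Rightarrow> ('j \<Rightarrow> 'm) \<Rightarrow> bool" where
  "is_cone J C D L p \<longleftrightarrow> L \<in> Ob C \<and>
     (\<forall>j \<in> Ob J. p j \<in> hom C L (fobj D j)) \<and>
     (\<forall>u \<in> Ar J. farr D u \<cdot>\<^bsub>C\<^esub> p (Dom J u) = p (Cod J u))"

definition is_limit ::
  "('j, 'k) cat \<Rightarrow> ('o, 'm) cat \<Rightarrow> ('j, 'k, 'o, 'm) funct \<Rightarrow> 'o \<Rightarrow> ('j \<Rightarrow> 'm) \<Rightarrow> bool" where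
  "is_limit J C D L p \<longleftrightarrow> is_cone J C D L p \<and>
     (\<forall>M q. is_cone J C D M q \<longrightarrow>
        (\<exists>!h. h \<in> hom C M L \<and> (\<forall>j \<in> Ob J. p j \<cdot>\<^bsub>C\<^esub> h = q j)))"

definition is_cocone ::
  "('j, 'k) cat \<Rightarrow> ('o, 'm) cat \<Rightarrow> ('j, 'k, 'o, 'm) funct \<Rightarrow> 'o \<Rightarrow> ('j \<Rightarrow> 'm) \<Rightarrow> bool" where
  "is_cocone J C D Q c \<longleftrightarrow> Q \<in> Ob C \<and>
     (\<forall>j \<in> Ob J. c j \<in> hom C (fobj D j) Q) \<and>
     (\<forall>u \<in> Ar J. c (Cod J u) \<cdot>\<^bsub>C\<^esub> farr D u = c (Dom J u))"

definition is_colimit ::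
  "('j, 'k) cat \<Rightarrow> ('o, 'm) cat \<Rightarrow> ('j, 'k, 'o, 'm) funct \<Rightarrow> 'o \<Rightarrow> ('j \<Rightarrow> 'm) \<Rightarrow> bool" where
  "is_colimit J C D Q c \<longleftrightarrow> is_cocone J C D Q c \<and>
     (\<forall>M d. is_cocone J C D M d \<longrightarrow>
        (\<exists>!h. h \<in> hom C Q M \<and> (\<forall>j \<in> Ob J. h \<cdot>\<^bsub>C\<^esub> c j = d j)))"

definition small_cat :: "('u set \<Rightarrow> bool) \<Rightarrow> ('u, 'u) cat \<Rightarrow> bool" where
  "small_cat small J \<longleftrightarrow> category J \<and> small (Ob J) \<and> small (Ar J)"

definition is_complete :: "('u set \<Rightarrow> bool) \<Rightarrow> ('o, 'm) cat \<Rightarrow> bool" where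
  "is_complete small C \<longleftrightarrow>
     (\<forall>J :: ('u, 'u) cat. \<forall>D. small_cat small J \<longrightarrow> is_functor J C D \<longrightarrow>
        (\<exists>L p. is_limit J C D L p))"

definition is_product :: "('o, 'm) cat \<Rightarrow> 'o \<Rightarrow> 'o \<Rightarrow> 'm \<Rightarrow> 'm \<Rightarrow> bool" where
  "is_product C X Y p q \<longleftrightarrow>
     p \<in> Ar C \<and> q \<in> Ar C \<and> Dom C p = Dom C q \<and> Cod C p = X \<and> Cod C q = Y \<and>
     (\<forall>Z. \<forall>f \<in> hom C Z X. \<forall>g \<in> hom C Z Y.
        \<exists>!h. h \<in> hom C Z (Dom C p) \<and> p \<cdot>\<^bsub>C\<^esub> h = f \<and> q \<cdot>\<^bsub>C\<^esub> h = g)"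

definition is_pullback :: "('o, 'm) cat \<Rightarrow> 'm \<Rightarrow> 'm \<Rightarrow> 'm \<Rightarrow> 'm \<Rightarrow> bool" where
  "is_pullback C f g p q \<longleftrightarrow>
     f \<in> Ar C \<and> g \<in> Ar C \<and> Cod C f = Cod C g \<and>
     p \<in> Ar C \<and> q \<in> Ar C \<and> Dom C p = Dom C q \<and> Cod C p = Dom C f \<and> Cod C q = Dom C g \<and>
     f \<cdot>\<^bsub>C\<^esub> p = g \<cdot>\<^bsub>C\<^esub> q \<and>
     (\<forall>Z. \<forall>x \<in> hom C Z (Dom C f). \<forall>y \<in> hom C Z (Dom C g). f \<cdot>\<^bsub>C\<^esub> x = g \<cdot>\<^bsub>C\<^esub> y \<longrightarrow>
        (\<exists>!h. h \<in> hom C Z (Dom C p) \<and> p \<cdot>\<^bsub>C\<^esub> h = x \<and> q \<cdot>\<^bsub>C\<^esub> h = y))"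

definition is_coproduct ::
  "('o, 'm) cat \<Rightarrow> 'i set \<Rightarrow> ('i \<Rightarrow> 'o) \<Rightarrow> 'o \<Rightarrow> ('i \<Rightarrow> 'm) \<Rightarrow> bool" where
  "is_coproduct C I X Q c \<longleftrightarrow> Q \<in> Ob C \<and> (\<forall>i \<in> I. c i \<in> hom C (X i) Q) \<and>
     (\<forall>M \<in> Ob C. \<forall>d. (\<forall>i \<in> I. d i \<in> hom C (X i) M) \<longrightarrow>
        (\<exists>!h. h \<in> hom C Q M \<and> (\<forall>i \<in> I. h \<cdot>\<^bsub>C\<^esub> c i = d i)))"

text \<open>Chosen coproducts, binary products and pullbacks; these are meaningful when the
  (co)limits in question exist. Every notion defined from them below is invariant under a change
  of the choices.\<close>

definition chosen_coprod :: "('o, 'm) cat \<Rightarrow> 'i set \<Rightarrow> ('i \<Rightarrow> 'o) \<Rightarrow> 'o \<times> ('i \<Rightarrow> 'm)" where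
  "chosen_coprod C I X = (SOME (Q, c). is_coproduct C I X Q c)"

definition coprod_map :: "('o, 'm) cat \<Rightarrow> 'i set \<Rightarrow> ('i \<Rightarrow> 'm) \<Rightarrow> 'm" where
  "coprod_map C I f =
     (let (Q, c) = chosen_coprod C I (\<lambda>i. Dom C (f i));
          (Q', c') = chosen_coprod C I (\<lambda>i. Cod C (f i))
      in THE h. h \<in> hom C Q Q' \<and> (\<forall>i \<in> I. h \<cdot>\<^bsub>C\<^esub> c i = c' i \<cdot>\<^bsub>C\<^esub> f i))"

definition chosen_product :: "('o, 'm) cat \<Rightarrow> 'o \<Rightarrow> 'o \<Rightarrow> 'm \<times> 'm" where
  "chosen_product C X Y = (SOME (p, q). is_product C X Y p q)"

definition proj1 :: "('o, 'm) cat \<Rightarrow> 'o \<Rightarrow> 'o \<Rightarrow> 'm" where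
  "proj1 C X Y = fst (chosen_product C X Y)"

definition proj2 :: "('o, 'm) cat \<Rightarrow> 'o \<Rightarrow> 'o \<Rightarrow> 'm" where
  "proj2 C X Y = snd (chosen_product C X Y)"

definition prod_ob :: "('o, 'm) cat \<Rightarrow> 'o \<Rightarrow> 'o \<Rightarrow> 'o" where
  "prod_ob C X Y = Dom C (proj1 C X Y)"

definition pairing :: "('o, 'm) cat \<Rightarrow> 'm \<Rightarrow> 'm \<Rightarrow> 'm" where
  "pairing C f g = (THE h. h \<in> hom C (Dom C f) (prod_ob C (Cod C f) (Cod C g)) \<and>
     proj1 C (Cod C f) (Cod C g) \<cdot>\<^bsub>C\<^esub> h = f \<and> proj2 C (Cod C f) (Cod C g) \<cdot>\<^bsub>C\<^esub> h = g)"

definition prod_map :: "('o, 'm) cat \<Rightarrow> 'm \<Rightarrow> 'm \<Rightarrow> 'm" where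
  "prod_map C f g = pairing C (f \<cdot>\<^bsub>C\<^esub> proj1 C (Dom C f) (Dom C g))
                              (g \<cdot>\<^bsub>C\<^esub> proj2 C (Dom C f) (Dom C g))"

definition chosen_pullback :: "('o, 'm) cat \<Rightarrow> 'm \<Rightarrow> 'm \<Rightarrow> 'm \<times> 'm" where
  "chosen_pullback C f g = (SOME (p, q). is_pullback C f g p q)"

section \<open>Monomorphisms, strong epimorphisms, subobjects\<close>

definition is_mono :: "('o, 'm) cat \<Rightarrow> 'm \<Rightarrow> bool" where
  "is_mono C m \<longleftrightarrow> m \<in> Ar C \<and>
     (\<forall>Z. \<forall>f \<in> hom C Z (Dom C m). \<forall>g \<in> hom C Z (Dom C m). m \<cdot>\<^bsub>C\<^esub> f = m \<cdot>\<^bsub>C\<^esub> g \<longrightarrow> f = g)"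

definition is_epi :: "('o, 'm) cat \<Rightarrow> 'm \<Rightarrow> bool" where
  "is_epi C e \<longleftrightarrow> e \<in> Ar C \<and>
     (\<forall>Z. \<forall>f \<in> hom C (Cod C e) Z. \<forall>g \<in> hom C (Cod C e) Z. f \<cdot>\<^bsub>C\<^esub> e = g \<cdot>\<^bsub>C\<^esub> e \<longrightarrow> f = g)"

definition strong_epi :: "('o, 'm) cat \<Rightarrow> 'm \<Rightarrow> bool" where
  "strong_epi C e \<longleftrightarrow> is_epi C e \<and>
     (\<forall>m. is_mono C m \<longrightarrow>
       (\<forall>f \<in> hom C (Dom C e) (Dom C m). \<forall>g \<in> hom C (Cod C e) (Cod C m).
          m \<cdot>\<^bsub>C\<^esub> f = g \<cdot>\<^bsub>C\<^esub> e \<longrightarrow>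
          (\<exists>d \<in> hom C (Cod C e) (Dom C m). d \<cdot>\<^bsub>C\<^esub> e = f \<and> m \<cdot>\<^bsub>C\<^esub> d = g)))"

text \<open>A subobject of \<open>X\<close> is represented by a monomorphism into \<open>X\<close>, and the order on subobjects
  by the preorder \<open>sub_le\<close>; monomorphisms that are \<open>sub_le\<close> each other denote the same is_subobject.\<close>

definition is_subobject :: "('o, 'm) cat \<Rightarrow> 'o \<Rightarrow> 'm \<Rightarrow> bool" where
  "is_subobject C X m \<longleftrightarrow> is_mono C m \<and> Cod C m = X"

definition sub_le :: "('o, 'm) cat \<Rightarrow> 'm \<Rightarrow> 'm \<Rightarrow> bool" where
  "sub_le C m n \<longleftrightarrow> (\<exists>h \<in> hom C (Dom C m) (Dom C n). n \<cdot>\<^bsub>C\<^esub> h = m)"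

definition sub_map :: "('o, 'm) cat \<Rightarrow> 'm \<Rightarrow> 'm \<Rightarrow> 'm" where
  "sub_map C m n = (THE h. h \<in> hom C (Dom C m) (Dom C n) \<and> n \<cdot>\<^bsub>C\<^esub> h = m)"

definition is_join :: "('o, 'm) cat \<Rightarrow> 'o \<Rightarrow> 'i set \<Rightarrow> ('i \<Rightarrow> 'm) \<Rightarrow> 'm \<Rightarrow> bool" where
  "is_join C X I m s \<longleftrightarrow> is_subobject C X s \<and> (\<forall>i \<in> I. sub_le C (m i) s) \<and>
     (\<forall>t. is_subobject C X t \<longrightarrow> (\<forall>i \<in> I. sub_le C (m i) t) \<longrightarrow> sub_le C s t)"

definition is_image :: "('o, 'm) cat \<Rightarrow> 'm \<Rightarrow> 'm \<Rightarrow> bool" where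
  "is_image C f m \<longleftrightarrow> is_mono C m \<and>
     (\<exists>e. strong_epi C e \<and> Dom C e = Dom C f \<and> Cod C e = Dom C m \<and> m \<cdot>\<^bsub>C\<^esub> e = f)"

definition image_of :: "('o, 'm) cat \<Rightarrow> 'm \<Rightarrow> 'm" where
  "image_of C f = (SOME m. is_image C f m)"

section \<open>Hypotheses on the category\<close>

definition has_finite_coproducts :: "('o, 'm) cat \<Rightarrow> bool" where
  "has_finite_coproducts C \<longleftrightarrow>
     (\<forall>(n :: nat) X. (\<forall>i < n. X i \<in> Ob C) \<longrightarrow> (\<exists>Q c. is_coproduct C {..<n} X Q c))"

definition well_powered :: "('u set \<Rightarrow> bool) \<Rightarrow> ('o, 'm) cat \<Rightarrow> bool" where
  "well_powered small C \<longleftrightarrow>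
     (\<forall>X \<in> Ob C. \<exists>(I :: 'u set) m. small I \<and> (\<forall>i \<in> I. is_subobject C X (m i)) \<and>
        (\<forall>s. is_subobject C X s \<longrightarrow> (\<exists>i \<in> I. sub_le C s (m i) \<and> sub_le C (m i) s)))"

definition monos_stable_under_finite_coproducts :: "('o, 'm) cat \<Rightarrow> bool" where
  "monos_stable_under_finite_coproducts C \<longleftrightarrow>
     (\<forall>(n :: nat) m. (\<forall>i < n. is_mono C (m i)) \<longrightarrow> is_mono C (coprod_map C {..<n} m))"

definition strong_epis_stable_under_pullback :: "('o, 'm) cat \<Rightarrow> bool" where
  "strong_epis_stable_under_pullback C \<longleftrightarrow>
     (\<forall>e g p q. strong_epi C e \<longrightarrow> is_pullback C e g p q \<longrightarrow> strong_epi C q)"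

definition has_image_factorizations :: "('o, 'm) cat \<Rightarrow> bool" where
  "has_image_factorizations C \<longleftrightarrow> (\<forall>f \<in> Ar C. \<exists>m. is_image C f m)"

definition has_small_coproducts :: "('u set \<Rightarrow> bool) \<Rightarrow> ('o, 'm) cat \<Rightarrow> bool" where
  "has_small_coproducts small C \<longleftrightarrow>
     (\<forall>I X. small I \<longrightarrow> (\<forall>i \<in> I. X i \<in> Ob C) \<longrightarrow> (\<exists>Q c. is_coproduct C I X Q c))"

definition coprod_functor ::
  "('o, 'm) cat \<Rightarrow> 'i set \<Rightarrow> ('i \<Rightarrow> 'm, 'i \<Rightarrow> 'm \<times> 'm \<times> 'm, 'm, 'm \<times> 'm \<times> 'm) funct" where
  "coprod_functor C I = \<lparr>
     fobj = coprod_map C I,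
     farr = (\<lambda>t. (coprod_map C I (\<lambda>i. fst (t i)),
                  coprod_map C I (\<lambda>i. fst (snd (t i))),
                  coprod_map C I (\<lambda>i. snd (snd (t i)))))\<rparr>"

definition infinitary_extensive :: "('u set \<Rightarrow> bool) \<Rightarrow> ('o, 'm) cat \<Rightarrow> bool" where
  "infinitary_extensive small C \<longleftrightarrow> has_small_coproducts small C \<and>
     (\<forall>(I :: 'u set) X. small I \<longrightarrow> (\<forall>i \<in> I. X i \<in> Ob C) \<longrightarrow>
        is_equivalence (prod_cat I (\<lambda>i. slice_cat C (X i)))
          (slice_cat C (fst (chosen_coprod C I X))) (coprod_functor C I))"

definition directed_poset :: "'i set \<Rightarrow> ('i \<times> 'i) set \<Rightarrow> bool" where
  "directed_poset I r \<longleftrightarrow> I \<noteq> {} \<and> r \<subseteq> I \<times> I \<and> partial_order_on I r \<and>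
     (\<forall>i \<in> I. \<forall>j \<in> I. \<exists>k \<in> I. (i, k) \<in> r \<and> (j, k) \<in> r)"

definition poset_cat :: "'i set \<Rightarrow> ('i \<times> 'i) set \<Rightarrow> ('i, 'i \<times> 'i) cat" where
  "poset_cat I r = \<lparr>Ob = I, Ar = r, Dom = fst, Cod = snd, Id = (\<lambda>i. (i, i)),
     Comp = (\<lambda>(_, k) (i, _). (i, k))\<rparr>"

definition sub_diagram :: "('o, 'm) cat \<Rightarrow> ('i \<Rightarrow> 'm) \<Rightarrow> ('i, 'i \<times> 'i, 'o, 'm) funct" where
  "sub_diagram C m = \<lparr>fobj = (\<lambda>i. Dom C (m i)), farr = (\<lambda>(i, j). sub_map C (m i) (m j))\<rparr>"

definition smooth_monos :: "('u set \<Rightarrow> bool) \<Rightarrow> ('o, 'm) cat \<Rightarrow> bool" where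
  "smooth_monos small C \<longleftrightarrow>
     (\<forall>X \<in> Ob C. \<forall>(I :: 'u set) r m s.
        small I \<longrightarrow> directed_poset I r \<longrightarrow> (\<forall>i \<in> I. is_subobject C X (m i)) \<longrightarrow>
        (\<forall>(i, j) \<in> r. sub_le C (m i) (m j)) \<longrightarrow> is_join C X I m s \<longrightarrow>
        is_colimit (poset_cat I r) C (sub_diagram C m) (Dom C s) (\<lambda>i. sub_map C (m i) s))"

section \<open>Hypotheses on the endofunctor\<close>

type_synonym ('o, 'm) endo = "('o, 'm, 'o, 'm) funct"

definition preserves_strong_epis :: "('o, 'm) cat \<Rightarrow> ('o, 'm) endo \<Rightarrow> bool" where
  "preserves_strong_epis C S \<longleftrightarrow> (\<forall>e. strong_epi C e \<longrightarrow> strong_epi C (farr S e))"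

definition preserves_monos :: "('o, 'm) cat \<Rightarrow> ('o, 'm) endo \<Rightarrow> bool" where
  "preserves_monos C S \<longleftrightarrow> (\<forall>m. is_mono C m \<longrightarrow> is_mono C (farr S m))"

definition preserves_directed_colimits ::
  "('u set \<Rightarrow> bool) \<Rightarrow> ('o, 'm) cat \<Rightarrow> ('o, 'm) endo \<Rightarrow> bool" where
  "preserves_directed_colimits small C S \<longleftrightarrow>
     (\<forall>(I :: 'u set) r D Q c.
        small I \<longrightarrow> directed_poset I r \<longrightarrow> is_functor (poset_cat I r) C D \<longrightarrow>
        is_colimit (poset_cat I r) C D Q c \<longrightarrow>
        is_colimit (poset_cat I r) C (comp_functor S D) (fobj S Q) (\<lambda>i. farr S (c i)))"

definition is_algebra :: "('o, 'm) cat \<Rightarrow> ('o, 'm) endo \<Rightarrow> 'o \<Rightarrow> 'm \<Rightarrow> bool" where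
  "is_algebra C S A a \<longleftrightarrow> A \<in> Ob C \<and> a \<in> hom C (fobj S A) A"

definition algebra_hom ::
  "('o, 'm) cat \<Rightarrow> ('o, 'm) endo \<Rightarrow> 'o \<Rightarrow> 'm \<Rightarrow> 'o \<Rightarrow> 'm \<Rightarrow> 'm \<Rightarrow> bool" where
  "algebra_hom C S A a B b h \<longleftrightarrow> h \<in> hom C A B \<and> h \<cdot>\<^bsub>C\<^esub> a = b \<cdot>\<^bsub>C\<^esub> farr S h"

definition initial_algebra :: "('o, 'm) cat \<Rightarrow> ('o, 'm) endo \<Rightarrow> 'o \<Rightarrow> 'm \<Rightarrow> bool" where
  "initial_algebra C S A a \<longleftrightarrow> is_algebra C S A a \<and>
     (\<forall>B b. is_algebra C S B b \<longrightarrow> (\<exists>!h. algebra_hom C S A a B b h))"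

section \<open>Relations, preorders and congruences\<close>

definition is_relation :: "('o, 'm) cat \<Rightarrow> 'o \<Rightarrow> 'm \<Rightarrow> bool" where
  "is_relation C X R \<longleftrightarrow> is_subobject C (prod_ob C X X) R"

definition rel_l :: "('o, 'm) cat \<Rightarrow> 'o \<Rightarrow> 'm \<Rightarrow> 'm" where
  "rel_l C X R = proj1 C X X \<cdot>\<^bsub>C\<^esub> R"

definition rel_r :: "('o, 'm) cat \<Rightarrow> 'o \<Rightarrow> 'm \<Rightarrow> 'm" where
  "rel_r C X R = proj2 C X X \<cdot>\<^bsub>C\<^esub> R"

definition diag :: "('o, 'm) cat \<Rightarrow> 'o \<Rightarrow> 'm" where
  "diag C X = pairing C (Id C X) (Id C X)"

definition rel_push :: "('o, 'm) cat \<Rightarrow> 'm \<Rightarrow> 'm \<Rightarrow> 'm" where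
  "rel_push C f R = image_of C (prod_map C f f \<cdot>\<^bsub>C\<^esub> R)"

definition rel_comp :: "('o, 'm) cat \<Rightarrow> 'o \<Rightarrow> 'm \<Rightarrow> 'm \<Rightarrow> 'm" where
  "rel_comp C X R S = (let (l, r) = chosen_pullback C (rel_r C X R) (rel_l C X S)
     in image_of C (pairing C (rel_l C X R \<cdot>\<^bsub>C\<^esub> l) (rel_r C X S \<cdot>\<^bsub>C\<^esub> r)))"

definition is_preorder :: "('o, 'm) cat \<Rightarrow> 'o \<Rightarrow> 'm \<Rightarrow> bool" where
  "is_preorder C X R \<longleftrightarrow>
     is_relation C X R \<and> sub_le C (diag C X) R \<and> sub_le C (rel_comp C X R R) R"

definition canonical_lifting :: "('o, 'm) cat \<Rightarrow> ('o, 'm) endo \<Rightarrow> 'o \<Rightarrow> 'm \<Rightarrow> 'm" where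
  "canonical_lifting C S X R = image_of C (pairing C (farr S (rel_l C X R)) (farr S (rel_r C X R)))"

definition is_congruence :: "('o, 'm) cat \<Rightarrow> ('o, 'm) endo \<Rightarrow> 'o \<Rightarrow> 'm \<Rightarrow> 'm \<Rightarrow> bool" where
  "is_congruence C S A a R \<longleftrightarrow>
     is_relation C A R \<and> sub_le C (rel_push C a (canonical_lifting C S A R)) R"

definition contextual_preorder ::
  "('o, 'm) cat \<Rightarrow> ('o, 'm) endo \<Rightarrow> 'o \<Rightarrow> 'm \<Rightarrow> 'm \<Rightarrow> 'm \<Rightarrow> bool" where
  "contextual_preorder C S A a P L \<longleftrightarrow>
     is_congruence C S A a L \<and> sub_le C L P \<and>
     (\<forall>R. is_congruence C S A a R \<longrightarrow> sub_le C R P \<longrightarrow> sub_le C R L)"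

end

theory Submission
  imports Defs
begin

text \<open>On an initial algebra every congruence is reflexive, because the initial morphism into a
  congruence is a common section of its projections. Congruences compose since \<open>\<Sigma>\<close> preserves
  strong epimorphisms, so for reflexive congruences \<open>R, S \<le> P\<close> the composite \<open>R \<cdot> S \<le> P \<cdot> P \<le> P\<close>
  is a congruence above both. The congruences below \<open>P\<close> therefore form a directed family. As
  monomorphisms are smooth and \<open>\<Sigma>\<close> preserves directed colimits, the algebra structures on its
  members induce one on the join, which is thus the greatest congruence below \<open>P\<close>.\<close>

section \<open>Images, joins and finite limits\<close>

text \<open>As defined, a congruence is an inequality between images and offers no map to compute
  with. Cancelling the strong epimorphisms of both factorizations by diagonal fill-in turns it into
  a map \<alpha>: \<Sigma>R \<rightarrow> R that commutes with both legs of R and with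
  \<open>a\<close>. The legs are jointly monic, so \<alpha> is unique; hence structures picked
  separately along a directed diagram are compatible and glue. The obstacle is that the join of two
  congruences need not be a congruence: an operation may take some arguments related by one and some
  by the other. This is why upper bounds are composites, and why reflexivity is needed to see the
  factors below them. Moreover, directed colimits are indexed by small posets, whereas subobjects
  are monomorphisms up to mutual inequality, so the family has to be indexed by one representative
  per class.\<close>

context category
begin

section \<open>Typing of composites, cancellation, diagonal fill-in and the order on
  subobjects\<close>

lemma Id_Ar [simp]: "X \<in> Ob C \<Longrightarrow> Id C X \<in> Ar C"
  and Dom_Id [simp]: "X \<in> Ob C \<Longrightarrow> Dom C (Id C X) = X"
  and Cod_Id [simp]: "X \<in> Ob C \<Longrightarrow> Cod C (Id C X) = X"
  using id_in by (auto simp: hom_def)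

lemma Comp_Ar [simp]: "\<lbrakk>f \<in> Ar C; g \<in> Ar C; Cod C f = Dom C g\<rbrakk> \<Longrightarrow> g \<cdot> f \<in> Ar C"
  and Dom_Comp [simp]: "\<lbrakk>f \<in> Ar C; g \<in> Ar C; Cod C f = Dom C g\<rbrakk> \<Longrightarrow> Dom C (g \<cdot> f) = Dom C f"
  and Cod_Comp [simp]: "\<lbrakk>f \<in> Ar C; g \<in> Ar C; Cod C f = Dom C g\<rbrakk> \<Longrightarrow> Cod C (g \<cdot> f) = Cod C g"
  using comp_in by (auto simp: hom_def)

lemma Comp_Id_left [simp]: "\<lbrakk>f \<in> Ar C; Cod C f = Y\<rbrakk> \<Longrightarrow> Id C Y \<cdot> f = f"
  and Comp_Id_right [simp]: "\<lbrakk>f \<in> Ar C; Dom C f = X\<rbrakk> \<Longrightarrow> f \<cdot> Id C X = f"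
  using id_left id_right by (auto simp: hom_def)

lemma Comp_assoc:
  "\<lbrakk>f \<in> Ar C; g \<in> Ar C; h \<in> Ar C; Cod C f = Dom C g; Cod C g = Dom C h\<rbrakk> \<Longrightarrow>
    (h \<cdot> g) \<cdot> f = h \<cdot> (g \<cdot> f)"
  using comp_assoc by (auto simp: hom_def)

lemma mono_Ar: "is_mono C m \<Longrightarrow> m \<in> Ar C"
  by (simp add: is_mono_def)

lemma mono_cancel:
  "\<lbrakk>is_mono C m; f \<in> Ar C; g \<in> Ar C; Cod C f = Dom C m; Cod C g = Dom C m; Dom C f = Dom C g;
    m \<cdot> f = m \<cdot> g\<rbrakk> \<Longrightarrow> f = g"
  by (auto simp: is_mono_def hom_def)

lemma strong_epi_Ar: "strong_epi C e \<Longrightarrow> e \<in> Ar C"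
  by (simp add: strong_epi_def is_epi_def)

lemma strong_epi_lift:
  assumes "strong_epi C e" "is_mono C m" "f \<in> Ar C" "g \<in> Ar C" "Dom C f = Dom C e"
    "Cod C f = Dom C m" "Dom C g = Cod C e" "Cod C g = Cod C m" "m \<cdot> f = g \<cdot> e"
  obtains d where "d \<in> Ar C" "Dom C d = Cod C e" "Cod C d = Dom C m" "d \<cdot> e = f" "m \<cdot> d = g"
  using assms unfolding strong_epi_def hom_def by fastforce

lemma sub_le_iff:
  "sub_le C m n \<longleftrightarrow> (\<exists>h \<in> Ar C. Dom C h = Dom C m \<and> Cod C h = Dom C n \<and> n \<cdot> h = m)"
  by (auto simp: sub_le_def hom_def)

lemma sub_le_refl: "m \<in> Ar C \<Longrightarrow> sub_le C m m"
  unfolding sub_le_iff by (intro bexI [of _ "Id C (Dom C m)"]) (simp_all add: dom_in)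

lemma sub_le_trans:
  assumes "sub_le C m n" "sub_le C n k" "k \<in> Ar C"
  shows "sub_le C m k"
proof -
  from assms obtain h h' where "h \<in> Ar C" "Dom C h = Dom C m" "Cod C h = Dom C n" "n \<cdot> h = m"
    "h' \<in> Ar C" "Dom C h' = Dom C n" "Cod C h' = Dom C k" "k \<cdot> h' = n"
    unfolding sub_le_iff by blast
  moreover from this have "k \<cdot> (h' \<cdot> h) = m"
    using \<open>k \<in> Ar C\<close> by (simp flip: Comp_assoc)
  ultimately show ?thesis
    unfolding sub_le_iff by (intro bexI [of _ "h' \<cdot> h"]) simp_all
qed

lemma sub_map_props:
  assumes "sub_le C m n" "is_mono C n"
  shows "sub_map C m n \<in> Ar C" "Dom C (sub_map C m n) = Dom C m"
    "Cod C (sub_map C m n) = Dom C n" "n \<cdot> sub_map C m n = m"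
proof -
  have "\<exists>!h. h \<in> hom C (Dom C m) (Dom C n) \<and> n \<cdot> h = m"
    using assms mono_cancel [of n] unfolding sub_le_iff hom_def by fastforce
  from theI' [OF this]
  show "sub_map C m n \<in> Ar C" "Dom C (sub_map C m n) = Dom C m"
    "Cod C (sub_map C m n) = Dom C n" "n \<cdot> sub_map C m n = m"
    unfolding sub_map_def hom_def by auto
qed

lemma sub_map_eqI:
  assumes "h \<in> Ar C" "Dom C h = Dom C m" "Cod C h = Dom C n" "n \<cdot> h = m" "is_mono C n"
  shows "sub_map C m n = h"
proof -
  have "sub_le C m n"
    using assms unfolding sub_le_iff by blast
  note k = sub_map_props [OF this assms(5)]
  show ?thesis
    using mono_cancel [OF assms(5)] assms k by metis
qed

section \<open>Images and joins of subobjects\<close>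

lemma image_of_is_image:
  assumes "has_image_factorizations C" "f \<in> Ar C"
  shows "is_image C f (image_of C f)"
  using assms unfolding has_image_factorizations_def image_of_def by (metis someI_ex)

lemma is_imageE:
  assumes "is_image C f m"
  obtains e where "strong_epi C e" "e \<in> Ar C" "Dom C e = Dom C f" "Cod C e = Dom C m" "m \<cdot> e = f"
    "is_mono C m" "m \<in> Ar C" "Cod C m = Cod C f"
  using assms strong_epi_Ar mono_Ar unfolding is_image_def by (metis Cod_Comp)

text \<open>Diagonal fill-in of \<open>g\<close> against the strong epimorphism onto
  \<open>n\<close>. It makes the image the least subobject through which \<open>f\<close>
  factors.\<close>

lemma image_leI:
  assumes f: "is_image C f n" and m: "is_mono C m"
    and g: "g \<in> Ar C" "Dom C g = Dom C f" "Cod C g = Dom C m" "m \<cdot> g = f"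
  shows "sub_le C n m"
proof -
  from f obtain e where e: "strong_epi C e" "e \<in> Ar C" "Dom C e = Dom C f" "Cod C e = Dom C n"
    "n \<cdot> e = f" "n \<in> Ar C" "Cod C n = Cod C f"
    by (rule is_imageE)
  have "Cod C f = Cod C m"
    using g m mono_Ar by force
  with e m g show ?thesis
    using strong_epi_lift [of e m g n] mono_Ar [OF m] unfolding sub_le_iff by metis
qed

lemma le_imageI:
  assumes "is_image C f n" "h \<in> Ar C" "Cod C h = Dom C f" "f \<in> Ar C" "f \<cdot> h = k"
  shows "sub_le C k n"
proof -
  from assms(1) obtain e where e: "e \<in> Ar C" "Dom C e = Dom C f" "Cod C e = Dom C n"
    "n \<cdot> e = f" "n \<in> Ar C"
    by (rule is_imageE)
  moreover have "n \<cdot> (e \<cdot> h) = k"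
    using e assms by (simp flip: Comp_assoc)
  moreover have "Dom C k = Dom C h"
    using assms by auto
  ultimately show ?thesis
    using assms unfolding sub_le_iff by (intro bexI [of _ "e \<cdot> h"]) simp_all
qed

text \<open>The join is the image of the cotuple of all \<open>m i\<close> on the coproduct of their
  domains. The coprojections place each \<open>m i\<close> below it, and a common upper bound
  \<open>t\<close> lets the cotuple factor through \<open>t\<close>, so minimality of the image
  applies.\<close>

lemma join_exists:
  assumes cop: "has_small_coproducts small C" and img: "has_image_factorizations C"
    and "small I" "X \<in> Ob C" and sub: "\<And>i. i \<in> I \<Longrightarrow> is_subobject C X (m i)"
  shows "\<exists>s. is_join C X I m s"
proof -
  have m: "m i \<in> Ar C" "is_mono C (m i)" "Cod C (m i) = X" if "i \<in> I" for i
    using sub [OF that] mono_Ar by (auto simp: is_subobject_def)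
  have "\<forall>i\<in>I. Dom C (m i) \<in> Ob C"
    using m dom_in by blast
  then obtain Q c where Q: "is_coproduct C I (\<lambda>i. Dom C (m i)) Q c"
    using cop \<open>small I\<close> unfolding has_small_coproducts_def by meson
  then have c: "c i \<in> Ar C" "Dom C (c i) = Dom C (m i)" "Cod C (c i) = Q" if "i \<in> I" for i
    using that by (auto simp: is_coproduct_def hom_def)
  have cotuple: "\<exists>!h. h \<in> hom C Q M \<and> (\<forall>i\<in>I. h \<cdot> c i = d i)"
    if "M \<in> Ob C" "\<And>i. i \<in> I \<Longrightarrow> d i \<in> hom C (Dom C (m i)) M" for M d
    using Q that unfolding is_coproduct_def by blast
  have m_hom: "\<And>i. i \<in> I \<Longrightarrow> m i \<in> hom C (Dom C (m i)) X"
    using m by (simp add: hom_def)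
  obtain f where "f \<in> hom C Q X" and fc: "\<forall>i\<in>I. f \<cdot> c i = m i"
    using ex1_implies_ex [OF cotuple [OF \<open>X \<in> Ob C\<close> m_hom]] by blast
  then have f: "f \<in> Ar C" "Dom C f = Q" "Cod C f = X" "\<And>i. i \<in> I \<Longrightarrow> f \<cdot> c i = m i"
    by (simp_all add: hom_def)
  define s where "s = image_of C f"
  have img_f: "is_image C f s"
    unfolding s_def using img f(1) by (rule image_of_is_image)
  then have s: "is_mono C s" "s \<in> Ar C" "Cod C s = X"
    using f by (auto elim: is_imageE)
  have ub: "sub_le C (m i) s" if "i \<in> I" for i
    using img_f c [OF that] f that by (intro le_imageI [of f s "c i"]) auto
  have least: "sub_le C s t" if t: "is_subobject C X t" "\<forall>i\<in>I. sub_le C (m i) t" for t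
  proof -
    have t': "is_mono C t" "t \<in> Ar C" "Cod C t = X"
      using t mono_Ar by (auto simp: is_subobject_def)
    note k = sub_map_props [OF t(2) [rule_format] t'(1)]
    have "\<And>i. i \<in> I \<Longrightarrow> sub_map C (m i) t \<in> hom C (Dom C (m i)) (Dom C t)"
      using k by (simp add: hom_def)
    from ex1_implies_ex [OF cotuple [OF dom_in [OF t'(2)] this]]
    obtain h where "h \<in> hom C Q (Dom C t)" "\<forall>i\<in>I. h \<cdot> c i = sub_map C (m i) t"
      by blast
    then have h: "h \<in> Ar C" "Dom C h = Q" "Cod C h = Dom C t"
      "\<And>i. i \<in> I \<Longrightarrow> h \<cdot> c i = sub_map C (m i) t"
      by (simp_all add: hom_def)
    \<comment> \<open>Both \<open>t \<cdot> h\<close> and \<open>f\<close> are cotuples of the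
      \<open>m i\<close>, so they coincide.\<close>
    have "t \<cdot> h \<in> hom C Q X \<and> (\<forall>i\<in>I. (t \<cdot> h) \<cdot> c i = m i)"
      using h t' c k by (auto simp: hom_def Comp_assoc)
    with \<open>f \<in> hom C Q X\<close> fc have "t \<cdot> h = f"
      using cotuple [OF \<open>X \<in> Ob C\<close> m_hom] by blast
    then show ?thesis
      using img_f t' h f by (intro image_leI [of f s t h]) auto
  qed
  show ?thesis
    using s ub least unfolding is_join_def is_subobject_def by blast
qed

text \<open>Completeness speaks of diagrams whose shape has its objects and arrows in the type of
  indices, so the two-object discrete shape is built from two elements of that type; these exist
  because the type is infinite.\<close>

lemma product_exists:
  assumes "smallness (small :: 'u set \<Rightarrow> bool)" "is_complete small C" "X \<in> Ob C" "Y \<in> Ob C"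
  shows "\<exists>p q. is_product C X Y p q"
proof -
  interpret smallness small by fact
  obtain B :: "'u set" where "finite B" "card B = 2"
    using infinite_arbitrarily_large [OF infinite_indices] by blast
  then obtain a b :: 'u where ab: "a \<noteq> b"
    by (auto simp: card_2_iff)
  \<comment> \<open>Each object serves as the name of its own identity. Composable arrows are equal,
    so returning either factor is correct.\<close>
  define J :: "('u, 'u) cat" where
    "J = \<lparr>Ob = {a, b}, Ar = {a, b}, Dom = (\<lambda>j. j), Cod = (\<lambda>j. j), Id = (\<lambda>j. j),
      Comp = (\<lambda>g f. g)\<rparr>"
  define F where "F = (\<lambda>j. if j = a then X else Y)"
  define D :: "('u, 'u, 'o, 'm) funct" where
    "D = \<lparr>fobj = F, farr = (\<lambda>j. Id C (F j))\<rparr>"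
  have "category J"
    by unfold_locales (auto simp: J_def hom_def)
  then have "small_cat small J"
    by (simp add: small_cat_def J_def small_finite)
  moreover have "is_functor J C D"
    using assms by (auto simp: is_functor_def J_def D_def F_def hom_def)
  ultimately obtain L p where L: "is_limit J C D L p"
    using assms(2) unfolding is_complete_def by blast
  have p: "p a \<in> hom C L X" "p b \<in> hom C L Y"
    using L ab by (auto simp: is_limit_def is_cone_def J_def D_def F_def)
  have "\<exists>!h. h \<in> hom C Z L \<and> p a \<cdot> h = f \<and> p b \<cdot> h = g"
    if fg: "f \<in> hom C Z X" "g \<in> hom C Z Y" for Z f g
  proof -
    have "is_cone J C D Z (\<lambda>j. if j = a then f else g)"
      using fg ab assms(3,4) dom_in
      by (auto simp: is_cone_def J_def D_def F_def hom_def)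
    then have "\<exists>!h. h \<in> hom C Z L \<and> (\<forall>j\<in>Ob J. p j \<cdot> h = (if j = a then f else g))"
      using L unfolding is_limit_def by blast
    then show ?thesis
      using ab by (simp add: J_def)
  qed
  with p have "is_product C X Y (p a) (p b)"
    by (auto simp: is_product_def hom_def)
  then show ?thesis by blast
qed

text \<open>The limit of a cospan, again with a shape encoded by elements of the index type: three
  objects, and two further elements for the arrows that are not identities.\<close>

lemma pullback_exists:
  assumes "smallness (small :: 'u set \<Rightarrow> bool)" "is_complete small C"
    and f: "f \<in> Ar C" and g: "g \<in> Ar C" and fg: "Cod C f = Cod C g"
  shows "\<exists>p q. is_pullback C f g p q"
proof -
  interpret smallness small by fact
  obtain \<nu> :: "nat \<Rightarrow> 'u" where \<nu>: "inj \<nu>"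
    using infinite_indices infinite_countable_subset by blast
  define x y z u v where "x = \<nu> 0" and "y = \<nu> 1" and "z = \<nu> 2" and "u = \<nu> 3" and "v = \<nu> 4"
  have dist: "distinct [x, y, z, u, v]"
    using \<nu> by (simp add: x_def y_def z_def u_def v_def inj_eq)
  \<comment> \<open>The shape is x \<rightarrow> z \<leftarrow> y with arrows \<open>u\<close> and
    \<open>v\<close>; identities carry the names of their objects. If the earlier factor is
    \<open>u\<close> or \<open>v\<close>, the later one is the identity of \<open>z\<close>;
    otherwise the earlier one is an identity. Either way the right factor is returned.\<close>
  define J :: "('u, 'u) cat" where
    "J = \<lparr>Ob = {x, y, z}, Ar = {x, y, z, u, v},
      Dom = (\<lambda>j. if j = u then x else if j = v then y else j),
      Cod = (\<lambda>j. if j = u \<or> j = v then z else j), Id = (\<lambda>j. j),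
      Comp = (\<lambda>k j. if j = u \<or> j = v then j else k)\<rparr>"
  define F where "F = (\<lambda>j. if j = x then Dom C f else if j = y then Dom C g else Cod C f)"
  define D :: "('u, 'u, 'o, 'm) funct" where
    "D = \<lparr>fobj = F, farr = (\<lambda>j. if j = u then f else if j = v then g else Id C (F j))\<rparr>"
  have "category J"
    using dist by unfold_locales (auto simp: J_def hom_def split: if_splits)
  then have "small_cat small J"
    by (simp add: small_cat_def J_def small_finite)
  moreover have "is_functor J C D"
    using dist f g fg dom_in cod_in
    by (auto simp: is_functor_def J_def D_def F_def hom_def)
  ultimately obtain L p where L: "is_limit J C D L p"
    using assms(2) unfolding is_complete_def by blast
  have p: "p x \<in> hom C L (Dom C f)" "p y \<in> hom C L (Dom C g)" "f \<cdot> p x = p z" "g \<cdot> p y = p z"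
    using L dist by (auto simp: is_limit_def is_cone_def J_def D_def F_def)
  have "\<exists>!h. h \<in> hom C Z L \<and> p x \<cdot> h = s \<and> p y \<cdot> h = t"
    if st: "s \<in> hom C Z (Dom C f)" "t \<in> hom C Z (Dom C g)" "f \<cdot> s = g \<cdot> t" for Z s t
  proof -
    \<comment> \<open>The leg at \<open>z\<close> is forced by commutation with \<open>u\<close>;
      commutation with \<open>v\<close> is the assumption on \<open>s\<close> and
      \<open>t\<close>.\<close>
    define q where "q = (\<lambda>j. if j = x then s else if j = y then t else f \<cdot> s)"
    have "is_cone J C D Z q"
      using st dist f g fg dom_in
      by (auto simp: is_cone_def J_def D_def F_def q_def hom_def)
    then have *: "\<exists>!h. h \<in> hom C Z L \<and> (\<forall>j\<in>Ob J. p j \<cdot> h = q j)"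
      using L unfolding is_limit_def by blast
    \<comment> \<open>The condition at \<open>z\<close> follows from the one at \<open>x\<close>,
      because \<open>p z\<close> is \<open>f \<cdot> p x\<close>.\<close>
    have "(\<forall>j\<in>Ob J. p j \<cdot> h = q j) \<longleftrightarrow> p x \<cdot> h = s \<and> p y \<cdot> h = t" if "h \<in> hom C Z L" for h
      using that dist p f by (auto simp: J_def q_def hom_def Comp_assoc simp flip: p(3))
    with * show ?thesis by (metis (no_types, lifting))
  qed
  with p f g fg have "is_pullback C f g (p x) (p y)"
    by (auto simp: is_pullback_def hom_def)
  then show ?thesis by blast
qed

end

section \<open>Relations\<close>

text \<open>Isolates the finite limits and images behind the calculus of relations, which thereby
  becomes independent of the notion of smallness.\<close>

locale relational_category = category +
  assumes products: "\<lbrakk>X \<in> Ob C; Y \<in> Ob C\<rbrakk> \<Longrightarrow> \<exists>p q. is_product C X Y p q"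
    and pullbacks: "\<lbrakk>f \<in> Ar C; g \<in> Ar C; Cod C f = Cod C g\<rbrakk> \<Longrightarrow> \<exists>p q. is_pullback C f g p q"
    and images: "has_image_factorizations C"
begin

section \<open>Universal properties of the chosen products and pullbacks\<close>

lemma is_product_proj:
  assumes "X \<in> Ob C" "Y \<in> Ob C"
  shows "is_product C X Y (proj1 C X Y) (proj2 C X Y)"
proof -
  have "\<exists>z. (\<lambda>(p, q). is_product C X Y p q) z"
    using products [OF assms] by auto
  then have "(\<lambda>(p, q). is_product C X Y p q) (chosen_product C X Y)"
    unfolding chosen_product_def by (rule someI_ex)
  then show ?thesis
    by (simp add: proj1_def proj2_def case_prod_beta)
qed

lemma proj_props [simp]:
  assumes "X \<in> Ob C" "Y \<in> Ob C"
  shows "proj1 C X Y \<in> Ar C" "Dom C (proj1 C X Y) = prod_ob C X Y" "Cod C (proj1 C X Y) = X"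
    "proj2 C X Y \<in> Ar C" "Dom C (proj2 C X Y) = prod_ob C X Y" "Cod C (proj2 C X Y) = Y"
  using is_product_proj [OF assms] by (auto simp: is_product_def prod_ob_def)

lemma prod_ob_in [simp]: "\<lbrakk>X \<in> Ob C; Y \<in> Ob C\<rbrakk> \<Longrightarrow> prod_ob C X Y \<in> Ob C"
  using dom_in [OF proj_props(1)] by simp

lemma prod_universal:
  assumes "f \<in> Ar C" "g \<in> Ar C" "Dom C f = Dom C g"
  shows "\<exists>!h. h \<in> hom C (Dom C f) (prod_ob C (Cod C f) (Cod C g)) \<and>
    proj1 C (Cod C f) (Cod C g) \<cdot> h = f \<and> proj2 C (Cod C f) (Cod C g) \<cdot> h = g"
proof -
  have "is_product C (Cod C f) (Cod C g) (proj1 C (Cod C f) (Cod C g)) (proj2 C (Cod C f) (Cod C g))"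
    using assms by (intro is_product_proj cod_in)
  moreover have "f \<in> hom C (Dom C f) (Cod C f)" "g \<in> hom C (Dom C f) (Cod C g)"
    using assms by (simp_all add: hom_def)
  ultimately show ?thesis
    unfolding is_product_def prod_ob_def by blast
qed

lemma pairing_props:
  assumes "f \<in> Ar C" "g \<in> Ar C" "Dom C f = Dom C g" "Cod C f = X" "Cod C g = Y"
  shows "pairing C f g \<in> Ar C" "Dom C (pairing C f g) = Dom C f"
    "Cod C (pairing C f g) = prod_ob C X Y"
    "proj1 C X Y \<cdot> pairing C f g = f" "proj2 C X Y \<cdot> pairing C f g = g"
  using theI' [OF prod_universal [OF assms(1-3)]] assms(4,5)
  unfolding pairing_def hom_def by auto

lemma prod_eqI:
  assumes "X \<in> Ob C" "Y \<in> Ob C" "f \<in> Ar C" "g \<in> Ar C" "Dom C f = Dom C g"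
    "Cod C f = prod_ob C X Y" "Cod C g = prod_ob C X Y"
    "proj1 C X Y \<cdot> f = proj1 C X Y \<cdot> g" "proj2 C X Y \<cdot> f = proj2 C X Y \<cdot> g"
  shows "f = g"
proof -
  let ?p = "proj1 C X Y \<cdot> f" and ?q = "proj2 C X Y \<cdot> f"
  have "\<exists>!h. h \<in> hom C (Dom C f) (prod_ob C X Y) \<and> proj1 C X Y \<cdot> h = ?p \<and> proj2 C X Y \<cdot> h = ?q"
    using prod_universal [of ?p ?q] assms(1-6) by simp
  moreover have "f \<in> hom C (Dom C f) (prod_ob C X Y)" "g \<in> hom C (Dom C f) (prod_ob C X Y)"
    using assms by (auto simp: hom_def)
  ultimately show ?thesis
    using assms(8,9) by metis
qed

lemma is_pullback_chosen:
  assumes "f \<in> Ar C" "g \<in> Ar C" "Cod C f = Cod C g"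
  obtains p q where "chosen_pullback C f g = (p, q)" "is_pullback C f g p q"
proof -
  have "\<exists>z. (\<lambda>(p, q). is_pullback C f g p q) z"
    using pullbacks [OF assms] by auto
  then have "(\<lambda>(p, q). is_pullback C f g p q) (chosen_pullback C f g)"
    unfolding chosen_pullback_def by (rule someI_ex)
  with that show ?thesis
    by (cases "chosen_pullback C f g") auto
qed

lemma is_pullbackD:
  assumes "is_pullback C f g p q"
  shows "p \<in> Ar C" "q \<in> Ar C" "Dom C q = Dom C p" "Cod C p = Dom C f" "Cod C q = Dom C g"
    "f \<cdot> p = g \<cdot> q"
  using assms by (auto simp: is_pullback_def)

lemma pullback_lift:
  assumes "is_pullback C f g p q" "x \<in> Ar C" "y \<in> Ar C" "Dom C x = Dom C y"
    "Cod C x = Dom C f" "Cod C y = Dom C g" "f \<cdot> x = g \<cdot> y"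
  obtains h where "h \<in> Ar C" "Dom C h = Dom C x" "Cod C h = Dom C p" "p \<cdot> h = x" "q \<cdot> h = y"
proof -
  have "x \<in> hom C (Dom C x) (Dom C f)" "y \<in> hom C (Dom C x) (Dom C g)"
    using assms by (simp_all add: hom_def)
  with assms have "\<exists>!h. h \<in> hom C (Dom C x) (Dom C p) \<and> p \<cdot> h = x \<and> q \<cdot> h = y"
    unfolding is_pullback_def by blast
  with that show ?thesis
    by (auto simp: hom_def)
qed

section \<open>Relations as jointly monic spans\<close>

lemma relationD:
  assumes "is_relation C X R" "X \<in> Ob C"
  shows "R \<in> Ar C" "is_mono C R" "Cod C R = prod_ob C X X"
    "rel_l C X R \<in> Ar C" "Dom C (rel_l C X R) = Dom C R" "Cod C (rel_l C X R) = X"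
    "rel_r C X R \<in> Ar C" "Dom C (rel_r C X R) = Dom C R" "Cod C (rel_r C X R) = X"
  using assms mono_Ar by (auto simp: is_relation_def is_subobject_def rel_l_def rel_r_def)

lemma relation_comp_eqI:
  assumes R: "is_relation C X R" "X \<in> Ob C"
    and "f \<in> Ar C" "Cod C f = Dom C R" "g \<in> Ar C" "Dom C g = Dom C f" "Cod C g = prod_ob C X X"
    and "rel_l C X R \<cdot> f = proj1 C X X \<cdot> g" "rel_r C X R \<cdot> f = proj2 C X X \<cdot> g"
  shows "R \<cdot> f = g"
  using assms relationD [OF R]
  by - (rule prod_eqI [of X X], simp_all add: rel_l_def rel_r_def Comp_assoc)

text \<open>The product projections are jointly monic and \<open>R\<close> is monic. This is what
  later forces algebra structures on relations to be natural in inclusions.\<close>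

lemma relation_jointly_mono:
  assumes R: "is_relation C X R" "X \<in> Ob C"
    and "f \<in> Ar C" "Cod C f = Dom C R" "g \<in> Ar C" "Dom C g = Dom C f" "Cod C g = Dom C R"
    and "rel_l C X R \<cdot> f = rel_l C X R \<cdot> g" "rel_r C X R \<cdot> f = rel_r C X R \<cdot> g"
  shows "f = g"
proof -
  have "R \<cdot> f = R \<cdot> g"
    using assms relationD [OF R]
    by - (rule relation_comp_eqI [OF R], simp_all add: rel_l_def rel_r_def Comp_assoc)
  then show ?thesis
    using assms relationD [OF R] mono_cancel [of R f g] by simp
qed

text \<open>With \<open>relation_leE\<close>, this allows an inclusion of relations to be treated as
  a morphism of spans, leg by leg.\<close>

lemma relation_leI:
  assumes R: "is_relation C X R" and Q: "is_relation C X Q" and X: "X \<in> Ob C"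
    and h: "h \<in> Ar C" "Dom C h = Dom C Q" "Cod C h = Dom C R"
    and "rel_l C X R \<cdot> h = rel_l C X Q" "rel_r C X R \<cdot> h = rel_r C X Q"
  shows "sub_le C Q R"
proof -
  have "R \<cdot> h = Q"
    using assms relationD [OF Q X]
    by - (rule relation_comp_eqI [OF R X], simp_all add: rel_l_def rel_r_def)
  with h show ?thesis
    unfolding sub_le_iff by blast
qed

lemma relation_leE:
  assumes R: "is_relation C X R" and X: "X \<in> Ob C" and le: "sub_le C Q R"
  obtains h where "h \<in> Ar C" "Dom C h = Dom C Q" "Cod C h = Dom C R" "R \<cdot> h = Q"
    "rel_l C X R \<cdot> h = rel_l C X Q" "rel_r C X R \<cdot> h = rel_r C X Q"
proof -
  from le obtain h where "h \<in> Ar C" "Dom C h = Dom C Q" "Cod C h = Dom C R" "R \<cdot> h = Q"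
    unfolding sub_le_iff by blast
  with that X relationD [OF R X] show ?thesis
    by (auto simp: rel_l_def rel_r_def Comp_assoc)
qed

section \<open>The diagonal and composition of relations\<close>

lemma diag_relation:
  assumes "X \<in> Ob C"
  shows "is_relation C X (diag C X)" "Dom C (diag C X) = X"
    "rel_l C X (diag C X) = Id C X" "rel_r C X (diag C X) = Id C X"
proof -
  note d = pairing_props [of "Id C X" "Id C X" X X, folded diag_def]
  show [simp]: "Dom C (diag C X) = X" and "rel_l C X (diag C X) = Id C X"
    and "rel_r C X (diag C X) = Id C X"
    using d assms by (simp_all add: rel_l_def rel_r_def)
  have "f = g" if fg: "f \<in> hom C Z X" "g \<in> hom C Z X" and eq: "diag C X \<cdot> f = diag C X \<cdot> g"
    for Z f g
  proof -
    \<comment> \<open>The first projection is a left inverse of the diagonal, which is therefore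
      monic.\<close>
    have "proj1 C X X \<cdot> (diag C X \<cdot> f) = proj1 C X X \<cdot> (diag C X \<cdot> g)"
      by (simp only: eq)
    then show ?thesis
      using d assms fg by (simp add: hom_def flip: Comp_assoc)
  qed
  then show "is_relation C X (diag C X)"
    using d assms by (auto simp: is_relation_def is_subobject_def is_mono_def)
qed

text \<open>Replaces the chosen pullback and image by a cover: the strong epimorphism
  \<open>e\<close> maps the pullback onto the composite and respects the outer legs. Maps out of the
  composite are later obtained by fill-in along \<open>e\<close>.\<close>

lemma rel_compE:
  assumes R: "is_relation C X R" and S: "is_relation C X S" and X: "X \<in> Ob C"
  obtains l r e where "is_pullback C (rel_r C X R) (rel_l C X S) l r"
    "is_relation C X (rel_comp C X R S)" "strong_epi C e" "e \<in> Ar C" "Dom C e = Dom C l"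
    "Cod C e = Dom C (rel_comp C X R S)"
    "rel_l C X (rel_comp C X R S) \<cdot> e = rel_l C X R \<cdot> l"
    "rel_r C X (rel_comp C X R S) \<cdot> e = rel_r C X S \<cdot> r"
proof -
  note [simp] = relationD [OF R X] relationD [OF S X] X
  obtain l r where lr: "chosen_pullback C (rel_r C X R) (rel_l C X S) = (l, r)"
    and pb: "is_pullback C (rel_r C X R) (rel_l C X S) l r"
    by (rule is_pullback_chosen [of "rel_r C X R" "rel_l C X S"]) simp_all
  note [simp] = is_pullbackD [OF pb]
  define f where "f = pairing C (rel_l C X R \<cdot> l) (rel_r C X S \<cdot> r)"
  have f: "f \<in> Ar C" "Dom C f = Dom C l" "Cod C f = prod_ob C X X"
    "proj1 C X X \<cdot> f = rel_l C X R \<cdot> l" "proj2 C X X \<cdot> f = rel_r C X S \<cdot> r"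
    using pairing_props [of "rel_l C X R \<cdot> l" "rel_r C X S \<cdot> r" X X] by (simp_all add: f_def)
  have "rel_comp C X R S = image_of C f"
    by (simp add: rel_comp_def lr f_def)
  then have "is_image C f (rel_comp C X R S)"
    using image_of_is_image [OF images f(1)] by simp
  then obtain e where e: "strong_epi C e" "e \<in> Ar C" "Dom C e = Dom C f"
    "Cod C e = Dom C (rel_comp C X R S)" "rel_comp C X R S \<cdot> e = f"
    "is_mono C (rel_comp C X R S)" "rel_comp C X R S \<in> Ar C"
    "Cod C (rel_comp C X R S) = Cod C f"
    by (rule is_imageE)
  have "is_relation C X (rel_comp C X R S)"
    using e f by (simp add: is_relation_def is_subobject_def)
  moreover have "rel_l C X (rel_comp C X R S) \<cdot> e = rel_l C X R \<cdot> l"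
    "rel_r C X (rel_comp C X R S) \<cdot> e = rel_r C X S \<cdot> r"
    using e f by (simp_all add: rel_l_def rel_r_def Comp_assoc)
  ultimately show ?thesis
    using that [OF pb] e f by simp
qed

text \<open>The two inclusions induce a map \<open>t\<close> between the pullbacks. It cannot be
  restricted to the images directly; it descends along \<open>e\<close> because the larger composite
  is monic.\<close>

lemma rel_comp_mono:
  assumes R: "is_relation C X R" and S: "is_relation C X S"
    and R': "is_relation C X R'" and S': "is_relation C X S'" and X: "X \<in> Ob C"
    and le: "sub_le C R R'" "sub_le C S S'"
  shows "sub_le C (rel_comp C X R S) (rel_comp C X R' S')"
proof -
  note [simp] = relationD [OF R X] relationD [OF S X] relationD [OF R' X] relationD [OF S' X]
  obtain l r e where pb: "is_pullback C (rel_r C X R) (rel_l C X S) l r"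
    and RS: "is_relation C X (rel_comp C X R S)" and e: "strong_epi C e" "e \<in> Ar C"
    "Dom C e = Dom C l" "Cod C e = Dom C (rel_comp C X R S)"
    "rel_l C X (rel_comp C X R S) \<cdot> e = rel_l C X R \<cdot> l"
    "rel_r C X (rel_comp C X R S) \<cdot> e = rel_r C X S \<cdot> r"
    using rel_compE [OF R S X] .
  obtain l' r' e' where pb': "is_pullback C (rel_r C X R') (rel_l C X S') l' r'"
    and RS': "is_relation C X (rel_comp C X R' S')" and e': "strong_epi C e'" "e' \<in> Ar C"
    "Dom C e' = Dom C l'" "Cod C e' = Dom C (rel_comp C X R' S')"
    "rel_l C X (rel_comp C X R' S') \<cdot> e' = rel_l C X R' \<cdot> l'"
    "rel_r C X (rel_comp C X R' S') \<cdot> e' = rel_r C X S' \<cdot> r'"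
    using rel_compE [OF R' S' X] .
  obtain h where h: "h \<in> Ar C" "Dom C h = Dom C R" "Cod C h = Dom C R'"
    "rel_l C X R' \<cdot> h = rel_l C X R" "rel_r C X R' \<cdot> h = rel_r C X R"
    using relation_leE [OF R' X le(1)] by blast
  obtain k where k: "k \<in> Ar C" "Dom C k = Dom C S" "Cod C k = Dom C S'"
    "rel_l C X S' \<cdot> k = rel_l C X S" "rel_r C X S' \<cdot> k = rel_r C X S"
    using relation_leE [OF S' X le(2)] by blast
  note p = is_pullbackD [OF pb] and p' = is_pullbackD [OF pb']
  \<comment> \<open>Inclusions preserve the middle component, so \<open>h \<cdot> l\<close> and
    \<open>k \<cdot> r\<close> form a cone over the second cospan.\<close>
  have "rel_r C X R' \<cdot> (h \<cdot> l) = rel_l C X S' \<cdot> (k \<cdot> r)"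
    using p h k by (simp flip: Comp_assoc)
  then obtain t where t: "t \<in> Ar C" "Dom C t = Dom C l" "Cod C t = Dom C l'"
    "l' \<cdot> t = h \<cdot> l" "r' \<cdot> t = k \<cdot> r"
    using p h k by (auto intro: pullback_lift [OF pb', of "h \<cdot> l" "k \<cdot> r"])
  note rs = relationD [OF RS X] and rs' = relationD [OF RS' X]
  have l: "rel_l C X (rel_comp C X R' S') \<cdot> (e' \<cdot> t) = rel_l C X R \<cdot> l"
  proof -
    have "rel_l C X (rel_comp C X R' S') \<cdot> (e' \<cdot> t) = (rel_l C X R' \<cdot> l') \<cdot> t"
      using rs' e' t by (simp flip: Comp_assoc)
    also have "\<dots> = rel_l C X R' \<cdot> (h \<cdot> l)"
      using p' t by (simp add: Comp_assoc)
    also have "\<dots> = rel_l C X R \<cdot> l"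
      using p h by (simp flip: Comp_assoc)
    finally show ?thesis .
  qed
  have r: "rel_r C X (rel_comp C X R' S') \<cdot> (e' \<cdot> t) = rel_r C X S \<cdot> r"
  proof -
    have "rel_r C X (rel_comp C X R' S') \<cdot> (e' \<cdot> t) = (rel_r C X S' \<cdot> r') \<cdot> t"
      using rs' e' t by (simp flip: Comp_assoc)
    also have "\<dots> = rel_r C X S' \<cdot> (k \<cdot> r)"
      using p' t by (simp add: Comp_assoc)
    also have "\<dots> = rel_r C X S \<cdot> r"
      using p k by (simp flip: Comp_assoc)
    finally show ?thesis .
  qed
  have "rel_comp C X R' S' \<cdot> (e' \<cdot> t) = rel_comp C X R S \<cdot> e"
    using l r e e' t rs rs' X
    by - (rule relation_comp_eqI [OF RS' X], simp_all add: rel_l_def rel_r_def Comp_assoc)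
  then obtain d where "d \<in> Ar C" "Dom C d = Dom C (rel_comp C X R S)"
    "Cod C d = Dom C (rel_comp C X R' S')" "rel_comp C X R' S' \<cdot> d = rel_comp C X R S"
    using e e' t rs rs'
    by (auto intro: strong_epi_lift [OF e(1) rs'(2), of "e' \<cdot> t" "rel_comp C X R S"])
  then show ?thesis
    unfolding sub_le_iff by blast
qed

text \<open>In generalized elements, \<open>f\<close> and \<open>g\<close> provide for each pair of
  \<open>Q\<close> a chain of an \<open>R\<close>-link and an \<open>S\<close>-link meeting in the
  middle. Such chains factor through the pullback, and \<open>e\<close> carries them into the
  composite.\<close>

lemma le_rel_comp:
  assumes R: "is_relation C X R" and S: "is_relation C X S" and X: "X \<in> Ob C"
    and Q: "is_relation C X Q"
    and f: "f \<in> Ar C" "Dom C f = Dom C Q" "Cod C f = Dom C R" "rel_l C X R \<cdot> f = rel_l C X Q"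
    and g: "g \<in> Ar C" "Dom C g = Dom C Q" "Cod C g = Dom C S" "rel_r C X S \<cdot> g = rel_r C X Q"
    and fg: "rel_r C X R \<cdot> f = rel_l C X S \<cdot> g"
  shows "sub_le C Q (rel_comp C X R S)"
proof -
  note [simp] = relationD [OF R X] relationD [OF S X]
  obtain l r e where pb: "is_pullback C (rel_r C X R) (rel_l C X S) l r"
    and RS: "is_relation C X (rel_comp C X R S)" and e: "e \<in> Ar C"
    "Dom C e = Dom C l" "Cod C e = Dom C (rel_comp C X R S)"
    "rel_l C X (rel_comp C X R S) \<cdot> e = rel_l C X R \<cdot> l"
    "rel_r C X (rel_comp C X R S) \<cdot> e = rel_r C X S \<cdot> r"
    using rel_compE [OF R S X] .
  note p = is_pullbackD [OF pb] and rs = relationD [OF RS X]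
  obtain t where t: "t \<in> Ar C" "Dom C t = Dom C Q" "Cod C t = Dom C l" "l \<cdot> t = f" "r \<cdot> t = g"
    using fg f g by (auto intro: pullback_lift [OF pb, of f g])
  have "rel_l C X (rel_comp C X R S) \<cdot> (e \<cdot> t) = (rel_l C X R \<cdot> l) \<cdot> t"
    "rel_r C X (rel_comp C X R S) \<cdot> (e \<cdot> t) = (rel_r C X S \<cdot> r) \<cdot> t"
    using e t rs by (simp_all flip: Comp_assoc)
  then show ?thesis
    using e t f g p rs by (intro relation_leI [OF RS Q X, of "e \<cdot> t"]) (simp_all add: Comp_assoc)
qed

text \<open>An \<open>R\<close>-link from x to y is followed by the trivial \<open>S\<close>-link at
  y, and an \<open>S\<close>-link is preceded by a trivial \<open>R\<close>-link. The trivial links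
  are the sections \<open>k\<close> and \<open>h\<close> obtained from reflexivity.\<close>

lemma le_rel_comp_reflexive:
  assumes R: "is_relation C X R" and S: "is_relation C X S" and X: "X \<in> Ob C"
    and refl: "sub_le C (diag C X) R" "sub_le C (diag C X) S"
  shows "sub_le C R (rel_comp C X R S)" "sub_le C S (rel_comp C X R S)"
proof -
  note [simp] = relationD [OF R X] relationD [OF S X] diag_relation [OF X] X
  obtain h where h: "h \<in> Ar C" "Dom C h = X" "Cod C h = Dom C R"
    "rel_l C X R \<cdot> h = Id C X" "rel_r C X R \<cdot> h = Id C X"
    using relation_leE [OF R X refl(1)] by auto
  obtain k where k: "k \<in> Ar C" "Dom C k = X" "Cod C k = Dom C S"
    "rel_l C X S \<cdot> k = Id C X" "rel_r C X S \<cdot> k = Id C X"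
    using relation_leE [OF S X refl(2)] by auto
  show "sub_le C R (rel_comp C X R S)"
    using k by (intro le_rel_comp [OF R S X R, of "Id C (Dom C R)" "k \<cdot> rel_r C X R"])
      (simp_all add: dom_in flip: Comp_assoc)
  show "sub_le C S (rel_comp C X R S)"
    using h by (intro le_rel_comp [OF R S X S, of "h \<cdot> rel_l C X S" "Id C (Dom C S)"])
      (simp_all add: dom_in flip: Comp_assoc)
qed

end

section \<open>Congruences\<close>

locale relational_endofunctor = relational_category +
  fixes S :: "('o, 'm) endo" and A :: 'o and a :: 'm
  assumes functorial: "is_functor C C S"
    and algebra: "is_algebra C S A a"
begin

section \<open>The endofunctor, and congruences as algebra structures\<close>

lemma farr_props [simp]:
  assumes "f \<in> Ar C"
  shows "farr S f \<in> Ar C" "Dom C (farr S f) = fobj S (Dom C f)" "Cod C (farr S f) = fobj S (Cod C f)"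
  using functorial assms by (auto simp: is_functor_def hom_def)

lemma farr_Comp: "\<lbrakk>f \<in> Ar C; g \<in> Ar C; Cod C f = Dom C g\<rbrakk> \<Longrightarrow> farr S (g \<cdot> f) = farr S g \<cdot> farr S f"
  using functorial by (auto simp: is_functor_def)

lemma farr_Id [simp]: "X \<in> Ob C \<Longrightarrow> farr S (Id C X) = Id C (fobj S X)"
  and fobj_in [simp]: "X \<in> Ob C \<Longrightarrow> fobj S X \<in> Ob C"
  using functorial by (auto simp: is_functor_def)

lemma algebraD [simp]: "A \<in> Ob C" "a \<in> Ar C" "Dom C a = fobj S A" "Cod C a = A"
  using algebra by (auto simp: is_algebra_def hom_def)

text \<open>Says that \<alpha> is a \<Sigma>-algebra on the domain of \<open>R\<close> for which
  both legs are algebra morphisms to \<open>(A, a)\<close>.\<close>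

definition structure_on :: "'m \<Rightarrow> 'm \<Rightarrow> bool" where
  "structure_on R \<alpha> \<longleftrightarrow> \<alpha> \<in> Ar C \<and> Dom C \<alpha> = fobj S (Dom C R) \<and> Cod C \<alpha> = Dom C R \<and>
     rel_l C A R \<cdot> \<alpha> = a \<cdot> farr S (rel_l C A R) \<and> rel_r C A R \<cdot> \<alpha> = a \<cdot> farr S (rel_r C A R)"

text \<open>Over \<Sigma>R, the lifting and its pushforward are both covered by strong epimorphisms
  \<open>e\<close> and \<open>e'\<close>. Composing with them turns an inclusion into a structure;
  conversely a structure descends along \<open>e\<close> by fill-in and past \<open>e'\<close> by
  minimality of the image.\<close>

lemma is_congruence_iff:
  "is_congruence C S A a R \<longleftrightarrow> is_relation C A R \<and> (\<exists>\<alpha>. structure_on R \<alpha>)"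
proof (cases "is_relation C A R")
  case R: True
  note [simp] = relationD [OF R algebraD(1)]
  \<comment> \<open>The lifting is the image of \<open>f\<close>; below, \<open>g\<close> is a
    \<times> a and \<open>k\<close> is its restriction to the lifting, so the pushforward is the
    image of \<open>k\<close>.\<close>
  define f where "f = pairing C (farr S (rel_l C A R)) (farr S (rel_r C A R))"
  have f: "f \<in> Ar C" "Dom C f = fobj S (Dom C R)" "Cod C f = prod_ob C (fobj S A) (fobj S A)"
    "proj1 C (fobj S A) (fobj S A) \<cdot> f = farr S (rel_l C A R)"
    "proj2 C (fobj S A) (fobj S A) \<cdot> f = farr S (rel_r C A R)"
    using pairing_props [of "farr S (rel_l C A R)" "farr S (rel_r C A R)" "fobj S A" "fobj S A"]
    by (simp_all add: f_def)
  obtain e where e: "strong_epi C e" "e \<in> Ar C" "Dom C e = Dom C f"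
    "Cod C e = Dom C (canonical_lifting C S A R)" "canonical_lifting C S A R \<cdot> e = f"
    "canonical_lifting C S A R \<in> Ar C" "Cod C (canonical_lifting C S A R) = Cod C f"
    using image_of_is_image [OF images f(1)]
    unfolding canonical_lifting_def f_def [symmetric] by (rule is_imageE)
  define g where "g = prod_map C a a"
  have g: "g \<in> Ar C" "Dom C g = prod_ob C (fobj S A) (fobj S A)" "Cod C g = prod_ob C A A"
    "proj1 C A A \<cdot> g = a \<cdot> proj1 C (fobj S A) (fobj S A)"
    "proj2 C A A \<cdot> g = a \<cdot> proj2 C (fobj S A) (fobj S A)"
    using pairing_props [of "a \<cdot> proj1 C (fobj S A) (fobj S A)"
        "a \<cdot> proj2 C (fobj S A) (fobj S A)" A A]
    by (simp_all add: g_def prod_map_def)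
  define k where "k = g \<cdot> canonical_lifting C S A R"
  have k: "k \<in> Ar C" "Dom C k = Cod C e" "Cod C k = prod_ob C A A" "k \<cdot> e = g \<cdot> f"
    using e f g by (simp_all add: k_def Comp_assoc)
  have push: "rel_push C a (canonical_lifting C S A R) = image_of C k"
    by (simp add: rel_push_def k_def g_def)
  have gf: "proj1 C A A \<cdot> (g \<cdot> f) = a \<cdot> farr S (rel_l C A R)"
    "proj2 C A A \<cdot> (g \<cdot> f) = a \<cdot> farr S (rel_r C A R)"
  proof -
    have "proj1 C A A \<cdot> (g \<cdot> f) = (proj1 C A A \<cdot> g) \<cdot> f"
      "proj2 C A A \<cdot> (g \<cdot> f) = (proj2 C A A \<cdot> g) \<cdot> f"
      using f(1-3) g(1-3) by (simp_all add: Comp_assoc)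
    then show "proj1 C A A \<cdot> (g \<cdot> f) = a \<cdot> farr S (rel_l C A R)"
      "proj2 C A A \<cdot> (g \<cdot> f) = a \<cdot> farr S (rel_r C A R)"
      using f by (simp_all add: g(4,5) Comp_assoc)
  qed
  obtain e' where e': "strong_epi C e'" "e' \<in> Ar C" "Dom C e' = Dom C k"
    "Cod C e' = Dom C (image_of C k)" "image_of C k \<cdot> e' = k"
    "image_of C k \<in> Ar C" "Cod C (image_of C k) = Cod C k"
    using image_of_is_image [OF images k(1)] by (rule is_imageE)
  have "sub_le C (image_of C k) R \<longleftrightarrow> (\<exists>\<alpha>. structure_on R \<alpha>)"
  proof
    assume "sub_le C (image_of C k) R"
    then obtain h where h: "h \<in> Ar C" "Dom C h = Dom C (image_of C k)" "Cod C h = Dom C R"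
      "R \<cdot> h = image_of C k"
      unfolding sub_le_iff by blast
    define \<alpha> where "\<alpha> = h \<cdot> (e' \<cdot> e)"
    have "R \<cdot> \<alpha> = (R \<cdot> h) \<cdot> (e' \<cdot> e)"
      unfolding \<alpha>_def using h e e' k by (subst Comp_assoc) simp_all
    also have "\<dots> = (image_of C k \<cdot> e') \<cdot> e"
      unfolding h(4) using e e' k by (subst Comp_assoc) simp_all
    also have "\<dots> = g \<cdot> f"
      using e' k by simp
    finally have R\<alpha>: "R \<cdot> \<alpha> = g \<cdot> f" .
    have \<alpha>: "\<alpha> \<in> Ar C" "Dom C \<alpha> = fobj S (Dom C R)" "Cod C \<alpha> = Dom C R"
      using h e e' k f by (simp_all add: \<alpha>_def)
    then have "structure_on R \<alpha>"
      unfolding structure_on_def using R\<alpha> gf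
      by (simp add: Comp_assoc rel_l_def [of C A R] rel_r_def [of C A R])
    then show "\<exists>\<alpha>. structure_on R \<alpha>" ..
  next
    assume "\<exists>\<alpha>. structure_on R \<alpha>"
    then obtain \<alpha> where \<alpha>: "\<alpha> \<in> Ar C" "Dom C \<alpha> = fobj S (Dom C R)" "Cod C \<alpha> = Dom C R"
      "rel_l C A R \<cdot> \<alpha> = a \<cdot> farr S (rel_l C A R)" "rel_r C A R \<cdot> \<alpha> = a \<cdot> farr S (rel_r C A R)"
      unfolding structure_on_def by blast
    have "R \<cdot> \<alpha> = g \<cdot> f"
      using \<alpha> f g gf by - (rule relation_comp_eqI [OF R algebraD(1)], simp_all)
    \<comment> \<open>Since \<open>R \<cdot> \<alpha> = k \<cdot> e\<close>, the diagonal of this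
      square factors \<open>k\<close> through \<open>R\<close>.\<close>
    then obtain d where d: "d \<in> Ar C" "Dom C d = Cod C e" "Cod C d = Dom C R" "R \<cdot> d = k"
      using \<alpha> k e f by (auto intro: strong_epi_lift [of e R \<alpha> k])
    show "sub_le C (image_of C k) R"
      using d k image_of_is_image [OF images k(1)] by (intro image_leI [of k _ R d]) simp_all
  qed
  with R show ?thesis
    by (simp add: is_congruence_def push)
qed (simp add: is_congruence_def)

lemma congruenceE:
  assumes "is_congruence C S A a R"
  obtains \<alpha> where "is_relation C A R" "\<alpha> \<in> Ar C" "Dom C \<alpha> = fobj S (Dom C R)" "Cod C \<alpha> = Dom C R"
    "rel_l C A R \<cdot> \<alpha> = a \<cdot> farr S (rel_l C A R)" "rel_r C A R \<cdot> \<alpha> = a \<cdot> farr S (rel_r C A R)"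
  using assms unfolding is_congruence_iff structure_on_def by blast

lemma congruenceI:
  assumes "is_relation C A R" "\<alpha> \<in> Ar C" "Dom C \<alpha> = fobj S (Dom C R)" "Cod C \<alpha> = Dom C R"
    "rel_l C A R \<cdot> \<alpha> = a \<cdot> farr S (rel_l C A R)" "rel_r C A R \<cdot> \<alpha> = a \<cdot> farr S (rel_r C A R)"
  shows "is_congruence C S A a R"
  using assms unfolding is_congruence_iff structure_on_def by blast

text \<open>Both legs are identities, so \<open>a\<close> itself is the structure. It makes the
  family of congruences nonempty.\<close>

lemma congruence_diag: "is_congruence C S A a (diag C A)"
  using diag_relation [OF algebraD(1)] by (intro congruenceI [of _ a]) simp_all

text \<open>The recurring computation with an algebra morphism \<open>q\<close> from \<gamma> to
  \<open>a\<close>: functoriality absorbs \<open>v\<close> into the leg.\<close>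

lemma compatible_comp:
  assumes "q \<in> Ar C" "Cod C q = A" "\<gamma> \<in> Ar C" "Cod C \<gamma> = Dom C q" "Dom C \<gamma> = fobj S (Dom C q)"
    "q \<cdot> \<gamma> = a \<cdot> farr S q" "v \<in> Ar C" "Cod C v = Dom C q"
  shows "q \<cdot> (\<gamma> \<cdot> farr S v) = a \<cdot> farr S (q \<cdot> v)"
proof -
  have "q \<cdot> (\<gamma> \<cdot> farr S v) = (q \<cdot> \<gamma>) \<cdot> farr S v"
    using assms(1-5,7,8) by (simp add: Comp_assoc)
  also have "\<dots> = a \<cdot> farr S (q \<cdot> v)"
    using assms by (simp add: Comp_assoc farr_Comp)
  finally show ?thesis .
qed

text \<open>Transports the structure along the isomorphism of domains given by \<open>h\<close> and
  \<open>k\<close>. Well-poweredness yields subobjects only up to such isomorphisms, so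
  representatives have to inherit the property.\<close>

lemma congruence_equiv:
  assumes Q: "is_congruence C S A a Q" and R: "is_relation C A R"
    and le: "sub_le C Q R" "sub_le C R Q"
  shows "is_congruence C S A a R"
proof -
  obtain \<alpha> where \<alpha>: "is_relation C A Q" "\<alpha> \<in> Ar C" "Dom C \<alpha> = fobj S (Dom C Q)" "Cod C \<alpha> = Dom C Q"
    "rel_l C A Q \<cdot> \<alpha> = a \<cdot> farr S (rel_l C A Q)" "rel_r C A Q \<cdot> \<alpha> = a \<cdot> farr S (rel_r C A Q)"
    using congruenceE [OF Q] .
  obtain h where h: "h \<in> Ar C" "Dom C h = Dom C Q" "Cod C h = Dom C R"
    "rel_l C A R \<cdot> h = rel_l C A Q" "rel_r C A R \<cdot> h = rel_r C A Q"
    using relation_leE [OF R algebraD(1) le(1)] by blast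
  obtain k where k: "k \<in> Ar C" "Dom C k = Dom C R" "Cod C k = Dom C Q"
    "rel_l C A Q \<cdot> k = rel_l C A R" "rel_r C A Q \<cdot> k = rel_r C A R"
    using relation_leE [OF \<alpha>(1) algebraD(1) le(2)] by blast
  note [simp] = relationD [OF R algebraD(1)] relationD [OF \<alpha>(1) algebraD(1)]
  have "rel_l C A R \<cdot> (h \<cdot> (\<alpha> \<cdot> farr S k)) = a \<cdot> farr S (rel_l C A R)"
  proof -
    have "rel_l C A R \<cdot> (h \<cdot> (\<alpha> \<cdot> farr S k)) = (rel_l C A R \<cdot> h) \<cdot> (\<alpha> \<cdot> farr S k)"
      using \<alpha> h k by (subst Comp_assoc) simp_all
    also have "\<dots> = a \<cdot> farr S (rel_l C A R)"
      using \<alpha> h k by (simp add: compatible_comp)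
    finally show ?thesis .
  qed
  moreover have "rel_r C A R \<cdot> (h \<cdot> (\<alpha> \<cdot> farr S k)) = a \<cdot> farr S (rel_r C A R)"
  proof -
    have "rel_r C A R \<cdot> (h \<cdot> (\<alpha> \<cdot> farr S k)) = (rel_r C A R \<cdot> h) \<cdot> (\<alpha> \<cdot> farr S k)"
      using \<alpha> h k by (subst Comp_assoc) simp_all
    also have "\<dots> = a \<cdot> farr S (rel_r C A R)"
      using \<alpha> h k by (simp add: compatible_comp)
    finally show ?thesis .
  qed
  ultimately show ?thesis
    using \<alpha> h k by (intro congruenceI [OF R, of "h \<cdot> (\<alpha> \<cdot> farr S k)"]) simp_all
qed

lemma congruence_reflexive:
  assumes init: "initial_algebra C S A a" and R: "is_congruence C S A a R"
  shows "sub_le C (diag C A) R"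
proof -
  obtain \<alpha> where \<alpha>: "is_relation C A R" "\<alpha> \<in> Ar C" "Dom C \<alpha> = fobj S (Dom C R)" "Cod C \<alpha> = Dom C R"
    "rel_l C A R \<cdot> \<alpha> = a \<cdot> farr S (rel_l C A R)" "rel_r C A R \<cdot> \<alpha> = a \<cdot> farr S (rel_r C A R)"
    using congruenceE [OF R] .
  note [simp] = relationD [OF \<alpha>(1) algebraD(1)]
  have "is_algebra C S (Dom C R) \<alpha>"
    using \<alpha> by (simp add: is_algebra_def hom_def dom_in)
  then obtain h where "algebra_hom C S A a (Dom C R) \<alpha> h"
    using init unfolding initial_algebra_def by blast
  then have h: "h \<in> Ar C" "Dom C h = A" "Cod C h = Dom C R" "h \<cdot> a = \<alpha> \<cdot> farr S h"
    by (auto simp: algebra_hom_def hom_def)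
  \<comment> \<open>For a leg \<open>p\<close>, the composite \<open>p \<cdot> h\<close> is an
    algebra endomorphism of the initial algebra, hence the identity.\<close>
  have splits: "p \<cdot> h = Id C A"
    if p: "p \<in> Ar C" "Dom C p = Dom C R" "Cod C p = A" "p \<cdot> \<alpha> = a \<cdot> farr S p" for p
  proof -
    have "(p \<cdot> h) \<cdot> a = (p \<cdot> \<alpha>) \<cdot> farr S h"
      using p(1-3) h \<alpha>(2-4) by (simp add: Comp_assoc)
    also have "\<dots> = a \<cdot> farr S (p \<cdot> h)"
      using p h \<alpha>(2-4) by (simp add: Comp_assoc farr_Comp)
    finally have "algebra_hom C S A a A a (p \<cdot> h)"
      using p h by (simp add: algebra_hom_def hom_def)
    moreover have "algebra_hom C S A a A a (Id C A)"
      by (simp add: algebra_hom_def hom_def)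
    ultimately show ?thesis
      using init unfolding initial_algebra_def by blast
  qed
  show ?thesis
    using h splits [of "rel_l C A R"] splits [of "rel_r C A R"] \<alpha> diag_relation [OF algebraD(1)]
    by (intro relation_leI [of A R "diag C A" h]) simp_all
qed

text \<open>The pullback carries a structure \<gamma> by its universal property, but the composite
  is only a quotient of the pullback. To push \<gamma> along \<open>e\<close>, the fill-in has to
  run against \<Sigma>e, which must therefore be a strong epimorphism.\<close>

lemma congruence_rel_comp:
  assumes se: "preserves_strong_epis C S"
    and Q: "is_congruence C S A a Q" and R: "is_congruence C S A a R"
  shows "is_congruence C S A a (rel_comp C A Q R)"
proof -
  obtain \<alpha> where \<alpha>: "is_relation C A Q" "\<alpha> \<in> Ar C" "Dom C \<alpha> = fobj S (Dom C Q)" "Cod C \<alpha> = Dom C Q"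
    "rel_l C A Q \<cdot> \<alpha> = a \<cdot> farr S (rel_l C A Q)" "rel_r C A Q \<cdot> \<alpha> = a \<cdot> farr S (rel_r C A Q)"
    using congruenceE [OF Q] .
  obtain \<beta> where \<beta>: "is_relation C A R" "\<beta> \<in> Ar C" "Dom C \<beta> = fobj S (Dom C R)" "Cod C \<beta> = Dom C R"
    "rel_l C A R \<cdot> \<beta> = a \<cdot> farr S (rel_l C A R)" "rel_r C A R \<cdot> \<beta> = a \<cdot> farr S (rel_r C A R)"
    using congruenceE [OF R] .
  note [simp] = relationD [OF \<alpha>(1) algebraD(1)] relationD [OF \<beta>(1) algebraD(1)]
  obtain l r e where pb: "is_pullback C (rel_r C A Q) (rel_l C A R) l r"
    and T: "is_relation C A (rel_comp C A Q R)" and e: "strong_epi C e" "e \<in> Ar C"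
    "Dom C e = Dom C l" "Cod C e = Dom C (rel_comp C A Q R)"
    and el: "rel_l C A (rel_comp C A Q R) \<cdot> e = rel_l C A Q \<cdot> l"
    and er: "rel_r C A (rel_comp C A Q R) \<cdot> e = rel_r C A R \<cdot> r"
    using rel_compE [OF \<alpha>(1) \<beta>(1) algebraD(1)] .
  note p = is_pullbackD [OF pb]
  \<comment> \<open>Both sides are \<open>a\<close> after \<Sigma> of the common middle leg of the
    pullback square.\<close>
  have "rel_r C A Q \<cdot> (\<alpha> \<cdot> farr S l) = rel_l C A R \<cdot> (\<beta> \<cdot> farr S r)"
    using \<alpha> \<beta> p by (simp add: compatible_comp)
  then obtain \<gamma> where \<gamma>: "\<gamma> \<in> Ar C" "Dom C \<gamma> = fobj S (Dom C l)" "Cod C \<gamma> = Dom C l"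
    "l \<cdot> \<gamma> = \<alpha> \<cdot> farr S l" "r \<cdot> \<gamma> = \<beta> \<cdot> farr S r"
    using \<alpha> \<beta> p by (auto intro: pullback_lift [OF pb, of "\<alpha> \<cdot> farr S l" "\<beta> \<cdot> farr S r"])
  define T' where "T' = rel_comp C A Q R"
  note [simp] = relationD [OF T algebraD(1), folded T'_def]
  note e = e [folded T'_def] and el = el [folded T'_def] and er = er [folded T'_def]
  \<comment> \<open>The value that \<open>T' \<cdot> \<delta>\<close> must have for \<delta> to be a
    structure on \<open>T'\<close>.\<close>
  define g where "g = pairing C (a \<cdot> farr S (rel_l C A T')) (a \<cdot> farr S (rel_r C A T'))"
  have g: "g \<in> Ar C" "Dom C g = fobj S (Dom C T')" "Cod C g = prod_ob C A A"
    "proj1 C A A \<cdot> g = a \<cdot> farr S (rel_l C A T')" "proj2 C A A \<cdot> g = a \<cdot> farr S (rel_r C A T')"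
    using pairing_props [of "a \<cdot> farr S (rel_l C A T')" "a \<cdot> farr S (rel_r C A T')" A A]
    by (simp_all add: g_def)
  have "rel_l C A T' \<cdot> (e \<cdot> \<gamma>) = proj1 C A A \<cdot> (g \<cdot> farr S e)"
  proof -
    have "rel_l C A T' \<cdot> (e \<cdot> \<gamma>) = (rel_l C A T' \<cdot> e) \<cdot> \<gamma>"
      using e \<gamma> by (simp add: Comp_assoc)
    also have "\<dots> = rel_l C A Q \<cdot> (\<alpha> \<cdot> farr S l)"
      using \<gamma> p by (simp add: el Comp_assoc)
    also have "\<dots> = a \<cdot> farr S (rel_l C A T' \<cdot> e)"
      using \<alpha> p by (simp add: el compatible_comp)
    also have "\<dots> = (proj1 C A A \<cdot> g) \<cdot> farr S e"
      unfolding g using e by (simp add: Comp_assoc farr_Comp)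
    also have "\<dots> = proj1 C A A \<cdot> (g \<cdot> farr S e)"
      using e g(1-3) by (simp add: Comp_assoc)
    finally show ?thesis .
  qed
  moreover have "rel_r C A T' \<cdot> (e \<cdot> \<gamma>) = proj2 C A A \<cdot> (g \<cdot> farr S e)"
  proof -
    have "rel_r C A T' \<cdot> (e \<cdot> \<gamma>) = (rel_r C A T' \<cdot> e) \<cdot> \<gamma>"
      using e \<gamma> by (simp add: Comp_assoc)
    also have "\<dots> = rel_r C A R \<cdot> (\<beta> \<cdot> farr S r)"
      using \<gamma> p by (simp add: er Comp_assoc)
    also have "\<dots> = a \<cdot> farr S (rel_r C A T' \<cdot> e)"
      using \<beta> p by (simp add: er compatible_comp)
    also have "\<dots> = (proj2 C A A \<cdot> g) \<cdot> farr S e"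
      unfolding g using e by (simp add: Comp_assoc farr_Comp)
    also have "\<dots> = proj2 C A A \<cdot> (g \<cdot> farr S e)"
      using e g(1-3) by (simp add: Comp_assoc)
    finally show ?thesis .
  qed
  ultimately have "T' \<cdot> (e \<cdot> \<gamma>) = g \<cdot> farr S e"
    using e \<gamma> g(1-3) T by - (rule relation_comp_eqI [of A], simp_all add: T'_def)
  moreover have "strong_epi C (farr S e)"
    using se e unfolding preserves_strong_epis_def by blast
  ultimately obtain \<delta> where \<delta>: "\<delta> \<in> Ar C" "Dom C \<delta> = fobj S (Dom C T')" "Cod C \<delta> = Dom C T'"
    "T' \<cdot> \<delta> = g"
    using e \<gamma> g(1-3) by (auto intro: strong_epi_lift [of "farr S e" T' "e \<cdot> \<gamma>" g])
  then have "rel_l C A T' \<cdot> \<delta> = proj1 C A A \<cdot> g" "rel_r C A T' \<cdot> \<delta> = proj2 C A A \<cdot> g"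
    by (simp_all add: rel_l_def rel_r_def Comp_assoc)
  with \<delta> show ?thesis
    unfolding g T'_def [symmetric] using T
    by (intro congruenceI [of T' \<delta>]) (simp_all add: T'_def)
qed

section \<open>Directed joins of congruences\<close>

lemma sub_diagram_functor:
  assumes r: "r \<subseteq> I \<times> I" and m: "\<And>i. i \<in> I \<Longrightarrow> is_mono C (m i)"
    and le: "\<And>i j. (i, j) \<in> r \<Longrightarrow> sub_le C (m i) (m j)"
  shows "is_functor (poset_cat I r) C (sub_diagram C m)"
proof -
  have mem: "i \<in> I \<and> j \<in> I" if "(i, j) \<in> r" for i j
    using r that by blast
  have s: "sub_map C (m i) (m j) \<in> Ar C" "Dom C (sub_map C (m i) (m j)) = Dom C (m i)"
    "Cod C (sub_map C (m i) (m j)) = Dom C (m j)" "m j \<cdot> sub_map C (m i) (m j) = m i"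
    if "(i, j) \<in> r" for i j
    using sub_map_props [OF le m] mem that by blast+
  \<comment> \<open>Maps into a subobject are determined by their composite with the monomorphism;
    this gives both functor laws.\<close>
  have "sub_map C (m i) (m i) = Id C (Dom C (m i))" if "i \<in> I" for i
    using mono_Ar [OF m [OF that]] m [OF that] dom_in by (intro sub_map_eqI) simp_all
  moreover have "sub_map C (m i) (m k) = sub_map C (m j) (m k) \<cdot> sub_map C (m i) (m j)"
    if "(i, j) \<in> r" "(j, k) \<in> r" for i j k
  proof (rule sub_map_eqI)
    show "m k \<cdot> (sub_map C (m j) (m k) \<cdot> sub_map C (m i) (m j)) = m i"
      using s [OF that(1)] s [OF that(2)] m mem [OF that(2)] mono_Ar by (simp flip: Comp_assoc)
  qed (use s [OF that(1)] s [OF that(2)] m mem [OF that(2)] in simp_all)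
  ultimately show ?thesis
    using s mem mono_Ar [OF m] dom_in
    unfolding is_functor_def poset_cat_def sub_diagram_def by (auto simp: hom_def)
qed

text \<open>Smoothness presents the domain of \<open>s\<close> as a directed colimit, and applying
  \<Sigma> gives a colimit again. The structures followed by the inclusions into \<open>s\<close>
  form a cocone on it, and the mediating map \<open>h\<close> is the structure on
  \<open>s\<close>.\<close>

lemma congruence_directed_join:
  fixes small :: "'u set \<Rightarrow> bool"
  assumes smooth: "smooth_monos small C" and pres: "preserves_directed_colimits small C S"
    and I: "small I" "directed_poset I r"
    and cong: "\<And>i. i \<in> I \<Longrightarrow> is_congruence C S A a (m i)"
    and le: "\<And>i j. (i, j) \<in> r \<Longrightarrow> sub_le C (m i) (m j)"
    and join: "is_join C (prod_ob C A A) I m s"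
  shows "is_congruence C S A a s"
proof -
  let ?J = "poset_cat I r" and ?D = "sub_diagram C m"
  let ?u = "\<lambda>i. sub_map C (m i) s"
  have rI: "i \<in> I" "j \<in> I" if "(i, j) \<in> r" for i j
    using I(2) that by (auto simp: directed_poset_def)
  have rel: "is_relation C A (m i)" if "i \<in> I" for i
    using cong [OF that] by (simp add: is_congruence_def)
  note mD = relationD [OF rel algebraD(1)]
  have s_rel: "is_relation C A s"
    using join by (simp add: is_relation_def is_join_def)
  note [simp] = relationD [OF s_rel algebraD(1)]
  have u: "?u i \<in> Ar C" "Dom C (?u i) = Dom C (m i)" "Cod C (?u i) = Dom C s" "s \<cdot> ?u i = m i"
    if "i \<in> I" for i
    using sub_map_props [of "m i" s] join that by (auto simp: is_join_def)
  have us: "rel_l C A s \<cdot> ?u i = rel_l C A (m i)" "rel_r C A s \<cdot> ?u i = rel_r C A (m i)"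
    if "i \<in> I" for i
    using u [OF that] by (simp_all add: rel_l_def rel_r_def Comp_assoc)
  have v: "sub_map C (m i) (m j) \<in> Ar C" "Dom C (sub_map C (m i) (m j)) = Dom C (m i)"
    "Cod C (sub_map C (m i) (m j)) = Dom C (m j)" "m j \<cdot> sub_map C (m i) (m j) = m i"
    if "(i, j) \<in> r" for i j
    using sub_map_props [OF le [OF that] mD(2)] rI that by blast+
  have vm: "rel_l C A (m j) \<cdot> sub_map C (m i) (m j) = rel_l C A (m i)"
    "rel_r C A (m j) \<cdot> sub_map C (m i) (m j) = rel_r C A (m i)" if "(i, j) \<in> r" for i j
    using v [OF that] mD [OF rI(2) [OF that]] by (simp_all add: rel_l_def rel_r_def Comp_assoc)
  have "is_functor ?J C ?D"
    using I(2) mD(2) le by (intro sub_diagram_functor) (auto simp: directed_poset_def)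
  moreover have "is_colimit ?J C ?D (Dom C s) ?u"
  proof -
    have "\<forall>i\<in>I. is_subobject C (prod_ob C A A) (m i)"
      using rel by (simp add: is_relation_def)
    moreover have "\<forall>(i, j)\<in>r. sub_le C (m i) (m j)"
      using le by blast
    moreover have "prod_ob C A A \<in> Ob C"
      by simp
    ultimately show ?thesis
      using smooth I join unfolding smooth_monos_def by blast
  qed
  ultimately have colim: "is_colimit ?J C (comp_functor S ?D) (fobj S (Dom C s)) (\<lambda>i. farr S (?u i))"
    using pres I unfolding preserves_directed_colimits_def by blast
  have universal: "\<exists>!h. h \<in> hom C (fobj S (Dom C s)) M \<and> (\<forall>i\<in>I. h \<cdot> farr S (?u i) = d i)"
    if "M \<in> Ob C" "\<And>i. i \<in> I \<Longrightarrow> d i \<in> hom C (fobj S (Dom C (m i))) M"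
      "\<And>i j. (i, j) \<in> r \<Longrightarrow> d j \<cdot> farr S (sub_map C (m i) (m j)) = d i" for M d
  proof -
    have "is_cocone ?J C (comp_functor S ?D) M d"
      using that by (auto simp: is_cocone_def poset_cat_def sub_diagram_def comp_functor_def)
    then show ?thesis
      using colim unfolding is_colimit_def by (simp add: poset_cat_def)
  qed
  obtain \<alpha> where \<alpha>: "\<And>i. i \<in> I \<Longrightarrow> structure_on (m i) (\<alpha> i)"
    using cong unfolding is_congruence_iff by metis
  then have \<alpha>D: "\<alpha> i \<in> Ar C" "Dom C (\<alpha> i) = fobj S (Dom C (m i))" "Cod C (\<alpha> i) = Dom C (m i)"
    "rel_l C A (m i) \<cdot> \<alpha> i = a \<cdot> farr S (rel_l C A (m i))"
    "rel_r C A (m i) \<cdot> \<alpha> i = a \<cdot> farr S (rel_r C A (m i))" if "i \<in> I" for i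
    using that by (simp_all add: structure_on_def)
  \<comment> \<open>The structures were chosen independently at each index. They are nevertheless
    natural: both sides have equal composites with the two legs of \<open>m j\<close>, which are
    jointly monic.\<close>
  have \<alpha>_nat: "\<alpha> j \<cdot> farr S (sub_map C (m i) (m j)) = sub_map C (m i) (m j) \<cdot> \<alpha> i"
    if ij: "(i, j) \<in> r" for i j
  proof -
    note [simp] = mD [OF rI(1) [OF ij]] mD [OF rI(2) [OF ij]] v [OF ij]
      \<alpha>D(1-3) [OF rI(1) [OF ij]] \<alpha>D(1-3) [OF rI(2) [OF ij]]
    have "p' \<cdot> (\<alpha> j \<cdot> farr S (sub_map C (m i) (m j))) = p' \<cdot> (sub_map C (m i) (m j) \<cdot> \<alpha> i)"
      if "p' \<in> Ar C" "Dom C p' = Dom C (m j)" "Cod C p' = A" "p' \<cdot> \<alpha> j = a \<cdot> farr S p'"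
        "p' \<cdot> sub_map C (m i) (m j) = p" "p \<cdot> \<alpha> i = a \<cdot> farr S p" for p p'
    proof -
      have "p' \<cdot> (sub_map C (m i) (m j) \<cdot> \<alpha> i) = p \<cdot> \<alpha> i"
        unfolding that(5) [symmetric] using that(1-3) by (subst Comp_assoc) simp_all
      with that show ?thesis
        by (simp add: compatible_comp)
    qed
    then show ?thesis
      using \<alpha>D(4,5) [OF rI(1) [OF ij]] \<alpha>D(4,5) [OF rI(2) [OF ij]] vm [OF ij]
      by - (rule relation_jointly_mono [OF rel [OF rI(2) [OF ij]] algebraD(1)], simp_all)
  qed
  have "\<exists>!h. h \<in> hom C (fobj S (Dom C s)) (Dom C s) \<and> (\<forall>i\<in>I. h \<cdot> farr S (?u i) = ?u i \<cdot> \<alpha> i)"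
  proof (rule universal)
    show "?u i \<cdot> \<alpha> i \<in> hom C (fobj S (Dom C (m i))) (Dom C s)" if "i \<in> I" for i
      using u [OF that] \<alpha>D [OF that] by (simp add: hom_def)
    show "(?u j \<cdot> \<alpha> j) \<cdot> farr S (sub_map C (m i) (m j)) = ?u i \<cdot> \<alpha> i" if ij: "(i, j) \<in> r" for i j
    proof -
      note k = u [OF rI(2) [OF ij]] v [OF ij] \<alpha>D(1-3) [OF rI(1) [OF ij]] \<alpha>D(1-3) [OF rI(2) [OF ij]]
      have "?u i = ?u j \<cdot> sub_map C (m i) (m j)"
        using k mD(1) [OF rI(1) [OF ij]] by (intro sub_map_eqI) (simp_all flip: Comp_assoc)
      then show ?thesis
        using k by (simp add: Comp_assoc \<alpha>_nat [OF ij])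
    qed
  qed (simp add: dom_in)
  then obtain h where "h \<in> hom C (fobj S (Dom C s)) (Dom C s)"
    and hu: "\<And>i. i \<in> I \<Longrightarrow> h \<cdot> farr S (?u i) = ?u i \<cdot> \<alpha> i"
    by blast
  then have h: "h \<in> Ar C" "Dom C h = fobj S (Dom C s)" "Cod C h = Dom C s"
    by (simp_all add: hom_def)
  \<comment> \<open>Stated for an arbitrary \<open>p\<close> so as to serve both legs of
    \<open>s\<close>. The two maps agree on every colimit injection, so uniqueness of the mediating
    map to \<open>A\<close> identifies them.\<close>
  have compatible: "p \<cdot> h = a \<cdot> farr S p"
    if p: "p \<in> Ar C" "Dom C p = Dom C s" "Cod C p = A"
      "\<And>i. i \<in> I \<Longrightarrow> (p \<cdot> ?u i) \<cdot> \<alpha> i = a \<cdot> farr S (p \<cdot> ?u i)" for p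
  proof -
    let ?d = "\<lambda>i. a \<cdot> farr S (p \<cdot> ?u i)"
    have "\<exists>!k. k \<in> hom C (fobj S (Dom C s)) A \<and> (\<forall>i\<in>I. k \<cdot> farr S (?u i) = ?d i)"
    proof (rule universal)
      show "?d i \<in> hom C (fobj S (Dom C (m i))) A" if "i \<in> I" for i
        using u [OF that] p by (simp add: hom_def)
      show "?d j \<cdot> farr S (sub_map C (m i) (m j)) = ?d i" if ij: "(i, j) \<in> r" for i j
      proof -
        note k = u [OF rI(2) [OF ij]] v [OF ij]
        have "?u i = ?u j \<cdot> sub_map C (m i) (m j)"
          using k mD(1) [OF rI(1) [OF ij]] by (intro sub_map_eqI) (simp_all flip: Comp_assoc)
        then show ?thesis
          using k p(1-3) by (simp add: Comp_assoc farr_Comp)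
      qed
    qed simp
    moreover have "p \<cdot> h \<in> hom C (fobj S (Dom C s)) A" "a \<cdot> farr S p \<in> hom C (fobj S (Dom C s)) A"
      using h p by (simp_all add: hom_def)
    moreover have "(p \<cdot> h) \<cdot> farr S (?u i) = ?d i" if "i \<in> I" for i
    proof -
      have "(p \<cdot> h) \<cdot> farr S (?u i) = (p \<cdot> ?u i) \<cdot> \<alpha> i"
        using h p(1-3) u [OF that] \<alpha>D(1-3) [OF that] hu [OF that] by (simp add: Comp_assoc)
      with p(4) that show ?thesis by simp
    qed
    moreover have "(a \<cdot> farr S p) \<cdot> farr S (?u i) = ?d i" if "i \<in> I" for i
      using p(1-3) u [OF that] by (simp add: Comp_assoc farr_Comp)
    ultimately show ?thesis by blast
  qed
  show ?thesis
    using h compatible us \<alpha>D(4,5) by (intro congruenceI [OF s_rel, of h]) simp_all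
qed

text \<open>Smooth joins need a small index set, while the congruences below \<open>P\<close> are
  arbitrary monomorphisms. Well-poweredness bridges this: a small family of representatives is
  cofinal among them, so its join dominates them all.\<close>

lemma contextual_preorder_exists:
  fixes small :: "'u set \<Rightarrow> bool"
  assumes "smallness small" and wp: "well_powered small C"
    and coproducts: "has_small_coproducts small C" and smooth: "smooth_monos small C"
    and init: "initial_algebra C S A a" and se: "preserves_strong_epis C S"
    and pres: "preserves_directed_colimits small C S" and P: "is_preorder C A P"
  shows "\<exists>L. contextual_preorder C S A a P L"
proof -
  interpret smallness small by fact
  have P_rel: "is_relation C A P" and P_refl: "sub_le C (diag C A) P"
    and P_trans: "sub_le C (rel_comp C A P P) P"
    using P by (auto simp: is_preorder_def)
  note P_Ar = relationD(1) [OF P_rel algebraD(1)]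
  have cong_rel: "is_relation C A R" and cong_Ar: "R \<in> Ar C" if "is_congruence C S A a R" for R
    using that relationD [OF _ algebraD(1)] by (auto simp: is_congruence_def)
  have "prod_ob C A A \<in> Ob C"
    by simp
  with wp obtain K :: "'u set" and m where "small K"
    and "\<forall>i\<in>K. is_subobject C (prod_ob C A A) (m i)"
    and "\<forall>R. is_subobject C (prod_ob C A A) R \<longrightarrow> (\<exists>i\<in>K. sub_le C R (m i) \<and> sub_le C (m i) R)"
    unfolding well_powered_def by blast
  then have K: "small K" "\<And>i. i \<in> K \<Longrightarrow> is_relation C A (m i)"
    "\<And>R. is_relation C A R \<Longrightarrow> \<exists>i\<in>K. sub_le C R (m i) \<and> sub_le C (m i) R"
    by (auto simp: is_relation_def)
  define eqv where "eqv i j \<longleftrightarrow> sub_le C (m i) (m j) \<and> sub_le C (m j) (m i)" for i j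
  \<comment> \<open>\<open>sub_le\<close> is only a preorder on the index set \<open>K\<close>; one index per class makes it antisymmetric.\<close>
  define rep where "rep i = (SOME j. j \<in> K \<and> eqv j i)" for i
  define I where "I = rep ` {i \<in> K. is_congruence C S A a (m i) \<and> sub_le C (m i) P}"
  have K_Ar: "m i \<in> Ar C" if "i \<in> K" for i
    using K(2) that relationD [OF _ algebraD(1)] by blast
  have rep: "rep i \<in> K" "eqv (rep i) i" if "i \<in> K" for i
  proof -
    have "i \<in> K \<and> eqv i i"
      using that K_Ar sub_le_refl by (simp add: eqv_def)
    then have "rep i \<in> K \<and> eqv (rep i) i"
      unfolding rep_def by (rule someI)
    then show "rep i \<in> K" "eqv (rep i) i" by simp_all
  qed
  have rep_eq: "rep i = rep j" if "eqv i j" "i \<in> K" "j \<in> K" for i j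
  proof -
    \<comment> \<open>Equivalent indices make the predicates under the choice operator agree, so the
      same representative is chosen.\<close>
    have "k \<in> K \<and> eqv k i \<longleftrightarrow> k \<in> K \<and> eqv k j" for k
      using that K_Ar sub_le_trans unfolding eqv_def by meson
    then show ?thesis
      by (simp add: rep_def)
  qed
  \<comment> \<open>The fixed-point property \<open>rep i = i\<close> on \<open>I\<close> is what
    gives antisymmetry of \<open>r\<close>.\<close>
  have I: "i \<in> K" "is_congruence C S A a (m i)" "sub_le C (m i) P" "rep i = i" if "i \<in> I" for i
  proof -
    from that obtain j where j: "j \<in> K" "is_congruence C S A a (m j)" "sub_le C (m j) P" "i = rep j"
      unfolding I_def by blast
    then show "i \<in> K" "rep i = i"
      using rep [OF j(1)] rep_eq [of "rep j" j] by auto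
    show "is_congruence C S A a (m i)"
      using congruence_equiv [OF j(2) K(2) [OF \<open>i \<in> K\<close>]] rep(2) [OF j(1)] j(4) by (simp add: eqv_def)
    show "sub_le C (m i) P"
      using rep(2) [OF j(1)] j(3,4) sub_le_trans [OF _ j(3) P_Ar] by (simp add: eqv_def)
  qed
  have cofinal: "\<exists>i\<in>I. sub_le C R (m i)" if R: "is_congruence C S A a R" "sub_le C R P" for R
  proof -
    obtain j where j: "j \<in> K" "sub_le C R (m j)" "sub_le C (m j) R"
      using K(3) [OF cong_rel [OF R(1)]] by blast
    then have "is_congruence C S A a (m j)" "sub_le C (m j) P"
      using congruence_equiv [OF R(1) K(2) [OF j(1)]] sub_le_trans [OF _ R(2) P_Ar] by auto
    then have "rep j \<in> I"
      using j(1) by (simp add: I_def)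
    moreover have "sub_le C R (m (rep j))"
      using sub_le_trans [OF j(2) _ K_Ar] rep [OF j(1)] by (simp add: eqv_def)
    ultimately show ?thesis ..
  qed
  have "small I"
    unfolding I_def by (intro small_image small_subset [OF K(1)]) auto
  define r where "r = {(i, j) \<in> I \<times> I. sub_le C (m i) (m j)}"
  have "directed_poset I r"
  proof -
    have "I \<noteq> {}"
      using cofinal [OF congruence_diag P_refl] by blast
    moreover have "partial_order_on I r"
    proof -
      have "refl_on I r"
        using I K_Ar sub_le_refl by (auto simp: refl_on_def r_def)
      moreover have "trans r"
        using I K_Ar sub_le_trans unfolding trans_def r_def by blast
      moreover have "antisym r"
      proof (rule antisymI)
        fix i j assume "(i, j) \<in> r" "(j, i) \<in> r"
        then have "rep i = rep j" "i \<in> I" "j \<in> I"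
          using I(1) by (auto simp: r_def eqv_def intro: rep_eq)
        then show "i = j"
          using I(4) by simp
      qed
      ultimately show ?thesis
        by (auto simp: partial_order_on_def preorder_on_def r_def)
    qed
    moreover have "\<exists>k\<in>I. (i, k) \<in> r \<and> (j, k) \<in> r" if ij: "i \<in> I" "j \<in> I" for i j
    proof -
      let ?T = "rel_comp C A (m i) (m j)"
      have T: "is_congruence C S A a ?T"
        using congruence_rel_comp [OF se] I(2) ij by blast
      have rel: "is_relation C A (m i)" "is_relation C A (m j)"
        using I(1) K(2) ij by auto
      have "sub_le C ?T (rel_comp C A P P)"
        using rel_comp_mono [OF rel P_rel P_rel algebraD(1)] I(3) ij by blast
      \<comment> \<open>Transitivity of \<open>P\<close> keeps the composite inside
        \<open>P\<close>, so that \<open>cofinal\<close> supplies an index above it.\<close>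
      then have "sub_le C ?T P"
        using sub_le_trans [OF _ P_trans P_Ar] by blast
      then obtain k where k: "k \<in> I" "sub_le C ?T (m k)"
        using cofinal [OF T] by blast
      moreover have "sub_le C (m i) ?T" "sub_le C (m j) ?T"
        using le_rel_comp_reflexive [OF rel algebraD(1)] congruence_reflexive [OF init I(2)] ij
        by auto
      ultimately show ?thesis
        using ij sub_le_trans [OF _ k(2) K_Ar [OF I(1) [OF k(1)]]] by (auto simp: r_def)
    qed
    ultimately show ?thesis
      by (auto simp: directed_poset_def r_def)
  qed
  obtain L where L: "is_join C (prod_ob C A A) I m L"
    using join_exists [OF coproducts images \<open>small I\<close> \<open>prod_ob C A A \<in> Ob C\<close>, of m] K(2) I(1)
    unfolding is_relation_def by blast
  have "is_congruence C S A a L"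
    using congruence_directed_join [OF smooth pres \<open>small I\<close> \<open>directed_poset I r\<close> _ _ L] I(2)
    by (auto simp: r_def)
  moreover have "sub_le C L P"
    using L I(3) P_rel unfolding is_join_def is_relation_def by blast
  moreover have "sub_le C R L" if "is_congruence C S A a R" "sub_le C R P" for R
  proof -
    obtain i where i: "i \<in> I" "sub_le C R (m i)"
      using cofinal [OF \<open>is_congruence C S A a R\<close> \<open>sub_le C R P\<close>] by blast
    moreover have "sub_le C (m i) L"
      using L i(1) by (simp add: is_join_def)
    ultimately show ?thesis
      using sub_le_trans cong_Ar [OF \<open>is_congruence C S A a L\<close>] by blast
  qed
  ultimately show ?thesis
    unfolding contextual_preorder_def by blast
qed

end

theorem theorem4p16:
  fixes small :: "'u set \<Rightarrow> bool"
    and C :: "('o, 'm) cat"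
    and \<Sigma> :: "('o, 'm) endo"
    and \<mu>\<Sigma> :: 'o and \<iota> :: 'm
  assumes "smallness small"
    and "category C"
    and "is_complete small C"
    and "has_finite_coproducts C"
    and "well_powered small C"
    and "monos_stable_under_finite_coproducts C"
    and "strong_epis_stable_under_pullback C"
    and "has_image_factorizations C"
    and "infinitary_extensive small C"
    and "smooth_monos small C"
    and "is_functor C C \<Sigma>"
    and "initial_algebra C \<Sigma> \<mu>\<Sigma> \<iota>"
    and "preserves_strong_epis C \<Sigma>"
    and "preserves_monos C \<Sigma>"
    and "preserves_directed_colimits small C \<Sigma>"
  shows "\<forall>P. is_preorder C \<mu>\<Sigma> P \<longrightarrow> (\<exists>L. contextual_preorder C \<Sigma> \<mu>\<Sigma> \<iota> P L)"
proof (intro allI impI)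
  fix P
  assume P: "is_preorder C \<mu>\<Sigma> P"
  interpret category C by fact
  \<comment> \<open>Completeness supplies the binary products and pullbacks through the finite
    shapes constructed earlier.\<close>
  interpret relational_endofunctor C \<Sigma> \<mu>\<Sigma> \<iota>
    using assms by unfold_locales
      (auto intro: product_exists pullback_exists simp: initial_algebra_def)
  have "has_small_coproducts small C"
    using assms by (simp add: infinitary_extensive_def)
  then show "\<exists>L. contextual_preorder C \<Sigma> \<mu>\<Sigma> \<iota> P L"
    using assms P by (intro contextual_preorder_exists [of small])
qed

end
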